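(* Suppose $(X,d)$ is a bounded infinite separable metric space, and there exists $\delta_0>0$ such that $\delta_0\le d(x,y)$ for all $x\ne y$ in $X$. Then $s_+(X,d)=+\infty$; in particular, $s_+(T_\mu)=s_+(K_\mu)=+\infty$ for every Borel probability measure $\mu$ on $X$ with full support.
   Context: For a real symmetric matrix or a compact self-adjoint operator $A$ on a Hilbert space, $s_+(A)$ denotes the number (possibly $+\infty$) of strictly positive eigenvalues of $A$, counted with multiplicity. For a finite subset $X_N=\{x_1,\dots,x_N\}$ of $(X,d)$, $S(X_N):=\left(-\tfrac12 d^2(x_i,x_j)\right)_{i,j=1}^N$, and $$s_+(X,d):=\sup\{s_+(S(X_N)) : X_N\subset X \text{ finite}\}.$$ A Borel probability measure $\mu$ on $X$ has full support if $\operatorname{supp}\mu=X$. The self-adjoint Hilbert–Schmidt operators $K_\mu,T_\mu$ on $L^2(X,\mu)$ are $$(K_\mu u)(x):=-\frac12\int_X d^2(x,y)u(y)\,d\mu(y),\qquad T_\mu:=P_\mu K_\mu P_\mu,$$ where $P_\mu$ is the orthogonal projector of $L^2(X,\mu)$ onto the orthogonal complement of the constant function $\mathbf 1$. *)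

theory Defs
  imports "HOL-Probability.Probability" "Jordan_Normal_Form.Char_Poly"
begin

definition pos_eigenvalues_mat :: "real mat \<Rightarrow> nat" where
  "pos_eigenvalues_mat A =
     (\<Sum>c\<in>{c. eigenvalue A c \<and> 0 < c}. order c (char_poly A))"

text \<open>The elements of \<open>L\<^sup>2(M)\<close> are represented by square-integrable functions; two of them
  represent the same vector iff they agree almost everywhere. Accordingly, eigenvalue equations
  and linear independence are read modulo null sets. Scalars are real.\<close>

definition L2_space :: "'a measure \<Rightarrow> ('a \<Rightarrow> real) set" where
  "L2_space M = {u \<in> borel_measurable M. integrable M (\<lambda>x. (u x)\<^sup>2)}"

definition L2_inner :: "'a measure \<Rightarrow> ('a \<Rightarrow> real) \<Rightarrow> ('a \<Rightarrow> real) \<Rightarrow> real" where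
  "L2_inner M u v = (LINT x|M. u x * v x)"

definition L2_eigenspace ::
    "'a measure \<Rightarrow> (('a \<Rightarrow> real) \<Rightarrow> 'a \<Rightarrow> real) \<Rightarrow> real \<Rightarrow> ('a \<Rightarrow> real) set" where
  "L2_eigenspace M A c = {u \<in> L2_space M. AE x in M. A u x = c * u x}"

definition L2_independent :: "'a measure \<Rightarrow> nat \<Rightarrow> (nat \<Rightarrow> 'a \<Rightarrow> real) \<Rightarrow> bool" where
  "L2_independent M n u \<longleftrightarrow>
     (\<forall>a. (AE x in M. (\<Sum>i<n. a i * u i x) = 0) \<longrightarrow> (\<forall>i<n. a i = 0))"

definition L2_dim :: "'a measure \<Rightarrow> ('a \<Rightarrow> real) set \<Rightarrow> enat" where
  "L2_dim M V = (SUP n \<in> {n. \<exists>u. (\<forall>i<n. u i \<in> V) \<and> L2_independent M n u}. enat n)"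

text \<open>The sum of the multiplicities \<open>dim ker (A - c)\<close> over all \<open>c > 0\<close>, as the supremum of its
  finite partial sums; the \<open>c\<close> that are not eigenvalues contribute \<open>0\<close>.\<close>

definition pos_eigenvalues_L2 ::
    "'a measure \<Rightarrow> (('a \<Rightarrow> real) \<Rightarrow> 'a \<Rightarrow> real) \<Rightarrow> enat" where
  "pos_eigenvalues_L2 M A =
     (SUP F \<in> {F. finite F \<and> F \<subseteq> {0<..}}. \<Sum>c\<in>F. L2_dim M (L2_eigenspace M A c))"

text \<open>A finite subset \<open>{x\<^sub>1, \<dots>, x\<^sub>N}\<close> is given by the distinct list of its elements.\<close>

definition S_mat :: "('a \<Rightarrow> 'a \<Rightarrow> real) \<Rightarrow> 'a list \<Rightarrow> real mat" where
  "S_mat d xs =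
     Matrix.mat (length xs) (length xs) (\<lambda>(i, j). - (1/2) * (d (xs ! i) (xs ! j))\<^sup>2)"

definition s_plus_space :: "'a set \<Rightarrow> ('a \<Rightarrow> 'a \<Rightarrow> real) \<Rightarrow> enat" where
  "s_plus_space X d =
     (SUP xs \<in> {xs. distinct xs \<and> set xs \<subseteq> X}. enat (pos_eigenvalues_mat (S_mat d xs)))"

definition borel_prob_measure :: "'a set \<Rightarrow> ('a \<Rightarrow> 'a \<Rightarrow> real) \<Rightarrow> 'a measure \<Rightarrow> bool" where
  "borel_prob_measure X d \<mu> \<longleftrightarrow>
     prob_space \<mu> \<and> space \<mu> = X \<and>
     sets \<mu> = sigma_sets X {U. openin (Metric_space.mtopology X d) U}"

definition measure_supp :: "'a set \<Rightarrow> ('a \<Rightarrow> 'a \<Rightarrow> real) \<Rightarrow> 'a measure \<Rightarrow> 'a set" where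
  "measure_supp X d \<mu> =
     {x \<in> X. \<forall>U. openin (Metric_space.mtopology X d) U \<and> x \<in> U \<longrightarrow> 0 < emeasure \<mu> U}"

definition K_op :: "('a \<Rightarrow> 'a \<Rightarrow> real) \<Rightarrow> 'a measure \<Rightarrow> ('a \<Rightarrow> real) \<Rightarrow> 'a \<Rightarrow> real" where
  "K_op d \<mu> u = (\<lambda>x. - (1/2) * (LINT y|\<mu>. (d x y)\<^sup>2 * u y))"

text \<open>The orthogonal projector onto the orthogonal complement of the constant function \<open>1\<close>.\<close>

definition P_op :: "'a measure \<Rightarrow> ('a \<Rightarrow> real) \<Rightarrow> 'a \<Rightarrow> real" where
  "P_op \<mu> u = (\<lambda>x. u x - L2_inner \<mu> u (\<lambda>_. 1) / L2_inner \<mu> (\<lambda>_. 1) (\<lambda>_. 1))"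

definition T_op :: "('a \<Rightarrow> 'a \<Rightarrow> real) \<Rightarrow> 'a measure \<Rightarrow> ('a \<Rightarrow> real) \<Rightarrow> 'a \<Rightarrow> real" where
  "T_op d \<mu> u = P_op \<mu> (K_op d \<mu> (P_op \<mu> u))"

end

theory Submission
  imports Defs "HOL-Complex_Analysis.Great_Picard" "HOL-Library.Ramsey"
begin

text \<open>All squared distances lie in a compact subset of \<open>(0, \<infinity>)\<close>, so by Ramsey's theorem \<open>X\<close> contains
  \<open>N\<close> points whose mutual squared distances are as close as desired to a common value \<open>c > 0\<close>. There
  \<open>S\<close> is close to \<open>c/2 (I - J)\<close>, where \<open>J\<close> is the all-ones matrix, hence positive on the
  \<open>(N - 1)\<close>-dimensional space of vectors of zero sum. Under full support every point of the discrete
  countable space \<open>X\<close> is an atom of \<open>\<mu>\<close>, so these vectors, divided by the masses of the points, become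
  functions orthogonal to \<open>1\<close> on which \<open>K\<^sub>\<mu>\<close> and \<open>T\<^sub>\<mu>\<close> have the same positive quadratic form. A
  subspace of dimension \<open>m\<close> on which the form of a compact self-adjoint operator is positive yields \<open>m\<close>
  positive eigenvalues, by successively maximising the form on the unit ball orthogonal to the
  eigenvectors already found. The matrices \<open>S\<close> are the case of the counting measure.\<close>

section \<open>Square-integrable functions on a countable space of atoms\<close>

text \<open>Points are atoms, so a function in \<open>L\<^sup>2\<close> is determined by its values and the quotient by
  null sets is trivial.\<close>

locale discrete_finite_measure = finite_measure M for M :: "'a measure" +
  assumes countable_space: "countable (space M)"
    and sets_eq_Pow: "sets M = Pow (space M)"
    and atom_pos: "x \<in> space M \<Longrightarrow> 0 < measure M {x}"
begin

lemma borel_measurable_any [simp]: "f \<in> borel_measurable M" for f :: "'a \<Rightarrow> 'b::topological_space"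
  by (simp add: measurable_def sets_eq_Pow)

lemma AE_iff_all: "(AE x in M. P x) \<longleftrightarrow> (\<forall>x\<in>space M. P x)"
proof
  assume "AE x in M. P x"
  then obtain N where N: "{x\<in>space M. \<not> P x} \<subseteq> N" "emeasure M N = 0" "N \<in> sets M"
    by (rule AE_E)
  have "P x" if x: "x \<in> space M" for x
  proof (rule ccontr)
    assume "\<not> P x"
    with x N have "{x} \<subseteq> N" by auto
    with N have "emeasure M {x} \<le> 0" by (metis emeasure_mono)
    then show False using atom_pos[OF x] by (simp add: measure_def)
  qed
  then show "\<forall>x\<in>space M. P x" by blast
qed auto

lemma L2_space_iff: "u \<in> L2_space M \<longleftrightarrow> integrable M (\<lambda>x. (u x)\<^sup>2)"
  by (simp add: L2_space_def)

lemma L2_integrable_mult: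
  assumes "u \<in> L2_space M" "v \<in> L2_space M"
  shows "integrable M (\<lambda>x. u x * v x)"
proof (rule Bochner_Integration.integrable_bound)
  show "integrable M (\<lambda>x. (u x)\<^sup>2 + (v x)\<^sup>2)"
    using assms by (simp add: L2_space_iff)
  have "\<bar>a * b\<bar> \<le> a\<^sup>2 + b\<^sup>2" for a b :: real
    using sum_squares_bound[of "\<bar>a\<bar>" "\<bar>b\<bar>"] abs_ge_zero[of "a * b"]
    by (simp only: power2_abs abs_mult mult.assoc)
  then show "AE x in M. norm (u x * v x) \<le> norm ((u x)\<^sup>2 + (v x)\<^sup>2)"
    by (intro AE_I2) simp
qed simp

lemma L2_add: "u \<in> L2_space M \<Longrightarrow> v \<in> L2_space M \<Longrightarrow> (\<lambda>x. u x + v x) \<in> L2_space M"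
  using L2_integrable_mult[of u v]
  by (simp add: L2_space_iff power2_sum mult.assoc)

lemma L2_scale: "u \<in> L2_space M \<Longrightarrow> (\<lambda>x. c * u x) \<in> L2_space M"
  by (simp add: L2_space_iff power_mult_distrib)

lemma L2_diff: "u \<in> L2_space M \<Longrightarrow> v \<in> L2_space M \<Longrightarrow> (\<lambda>x. u x - v x) \<in> L2_space M"
  using L2_add[OF _ L2_scale, of u v "-1"] by simp

lemma L2_bounded:
  assumes "\<And>x. x \<in> space M \<Longrightarrow> \<bar>u x\<bar> \<le> B"
  shows "u \<in> L2_space M"
  unfolding L2_space_iff
proof (rule integrable_const_bound[where B="B\<^sup>2"])
  show "AE x in M. norm ((u x)\<^sup>2) \<le> B\<^sup>2"
  proof (rule AE_I2)
    fix x assume "x \<in> space M"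
    then have "\<bar>u x\<bar>\<^sup>2 \<le> B\<^sup>2" by (intro power_mono assms) auto
    then show "norm ((u x)\<^sup>2) \<le> B\<^sup>2" by simp
  qed
qed simp

lemma L2_const [simp]: "(\<lambda>_. c) \<in> L2_space M"
  by (rule L2_bounded) (rule order_refl)

lemma L2_integrable: "u \<in> L2_space M \<Longrightarrow> integrable M u"
  using L2_integrable_mult[of u "\<lambda>_. 1"] by simp

section \<open>The inner product of \<open>L2_space M\<close>\<close>

lemma L2_inner_commute: "L2_inner M u v = L2_inner M v u"
  by (simp add: L2_inner_def mult.commute)

lemma L2_inner_add_left:
  "\<lbrakk>u \<in> L2_space M; v \<in> L2_space M; w \<in> L2_space M\<rbrakk>
    \<Longrightarrow> L2_inner M (\<lambda>x. u x + v x) w = L2_inner M u w + L2_inner M v w"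
  by (simp add: L2_inner_def distrib_right L2_integrable_mult)

lemma L2_inner_diff_left:
  "\<lbrakk>u \<in> L2_space M; v \<in> L2_space M; w \<in> L2_space M\<rbrakk>
    \<Longrightarrow> L2_inner M (\<lambda>x. u x - v x) w = L2_inner M u w - L2_inner M v w"
  by (simp add: L2_inner_def left_diff_distrib L2_integrable_mult)

lemma L2_inner_scale_left: "L2_inner M (\<lambda>x. c * u x) w = c * L2_inner M u w"
  by (simp add: L2_inner_def mult.assoc)

lemma L2_inner_add_right:
  "\<lbrakk>u \<in> L2_space M; v \<in> L2_space M; w \<in> L2_space M\<rbrakk>
    \<Longrightarrow> L2_inner M w (\<lambda>x. u x + v x) = L2_inner M w u + L2_inner M w v"
  by (simp add: L2_inner_commute[of w] L2_inner_add_left)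

lemma L2_inner_diff_right:
  "\<lbrakk>u \<in> L2_space M; v \<in> L2_space M; w \<in> L2_space M\<rbrakk>
    \<Longrightarrow> L2_inner M w (\<lambda>x. u x - v x) = L2_inner M w u - L2_inner M w v"
  by (simp add: L2_inner_commute[of w] L2_inner_diff_left)

lemma L2_inner_scale_right: "L2_inner M w (\<lambda>x. c * u x) = c * L2_inner M w u"
  by (simp add: L2_inner_commute[of w] L2_inner_scale_left)

lemma L2_inner_cong:
  "(\<And>x. x \<in> space M \<Longrightarrow> u x = u' x) \<Longrightarrow> L2_inner M u v = L2_inner M u' v"
  by (auto simp: L2_inner_def intro!: Bochner_Integration.integral_cong)

lemma L2_inner_self: "L2_inner M u u = (LINT x|M. (u x)\<^sup>2)"
  by (simp add: L2_inner_def power2_eq_square)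

lemma L2_inner_self_nonneg: "0 \<le> L2_inner M u u"
  by (simp add: L2_inner_self)

lemma L2_inner_self_eq_0:
  assumes "u \<in> L2_space M" "L2_inner M u u = 0" "x \<in> space M"
  shows "u x = 0"
proof -
  have "AE x in M. (u x)\<^sup>2 = 0"
    using assms by (subst integral_nonneg_eq_0_iff_AE[symmetric]) (auto simp: L2_space_iff L2_inner_self)
  then show ?thesis using assms(3) by (simp add: AE_iff_all)
qed

section \<open>L1 estimates, atoms and compactness\<close>

text \<open>Integrate \<open>\<bar>a\<bar> \<le> 1 + a\<^sup>2\<close>. This is cruder than
  Cauchy-Schwarz, but it bounds the L1 norm uniformly on the L2 unit ball, which is what the
  variational argument uses.\<close>

lemma L1_norm_le:
  assumes "u \<in> L2_space M"
  shows "(LINT x|M. \<bar>u x\<bar>) \<le> measure M (space M) + L2_inner M u u"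
proof -
  have "\<bar>a\<bar> \<le> 1 + a\<^sup>2" for a :: real
    using sum_squares_bound[of 1 "\<bar>a\<bar>"] abs_ge_zero[of a] by (simp only: power2_abs) simp
  then have "(LINT x|M. \<bar>u x\<bar>) \<le> (LINT x|M. 1 + (u x)\<^sup>2)"
    using assms L2_integrable[OF assms]
    by (intro integral_mono) (auto simp: L2_space_iff)
  also have "\<dots> = measure M (space M) + L2_inner M u u"
    using assms by (simp add: L2_space_iff L2_inner_self)
  finally show ?thesis .
qed

text \<open>The pairing of a bounded function with an integrable one. It gives the sup-norm bounds
  for integral operators and lets pairings with bounded functions pass to L1 limits.\<close>

lemma abs_integral_mult_le:
  assumes "u \<in> L2_space M" "\<And>x. x \<in> space M \<Longrightarrow> \<bar>b x\<bar> \<le> B"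
  shows "\<bar>L2_inner M b u\<bar> \<le> B * (LINT x|M. \<bar>u x\<bar>)"
proof -
  have "\<bar>L2_inner M b u\<bar> \<le> (LINT x|M. \<bar>b x * u x\<bar>)"
    unfolding L2_inner_def by (rule integral_abs_bound)
  also have "\<dots> \<le> (LINT x|M. B * \<bar>u x\<bar>)"
    using assms integrable_abs[OF L2_integrable_mult[OF L2_bounded[of b B] assms(1)]]
      L2_integrable[OF assms(1)]
    by (intro integral_mono) (auto simp: abs_mult intro!: mult_right_mono)
  finally show ?thesis by simp
qed

text \<open>On the space, \<open>f\<close> is a finite combination of indicators of atoms, which is
  integrated term by term.\<close>

lemma integral_finite_support:
  fixes f :: "'a \<Rightarrow> real"
  assumes "finite F" "F \<subseteq> space M" "\<And>x. x \<in> space M - F \<Longrightarrow> f x = 0"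
  shows "(LINT x|M. f x) = (\<Sum>x\<in>F. f x * measure M {x})"
proof -
  have "(LINT x|M. f x) = (LINT x|M. (\<Sum>y\<in>F. f y * indicator {y} x))"
  proof (rule Bochner_Integration.integral_cong[OF refl])
    fix x assume x: "x \<in> space M"
    have "(\<Sum>y\<in>F. f y * indicator {y} x) = (\<Sum>y\<in>F. if x = y then f y else 0)"
      by (intro sum.cong) (auto simp: indicator_def)
    then show "f x = (\<Sum>y\<in>F. f y * indicator {y} x)"
      using assms x by (auto simp: sum.delta)
  qed
  also have "\<dots> = (\<Sum>y\<in>F. LINT x|M. f y * indicator {y} x)"
    using assms by (intro Bochner_Integration.integral_sum integrable_mult_right integrable_real_indicator)
      (auto simp: sets_eq_Pow less_top[symmetric])
  also have "\<dots> = (\<Sum>y\<in>F. f y * measure M {y})"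
    using assms by (intro sum.cong) (auto simp: Int_absorb2 insert_absorb)
  finally show ?thesis .
qed

text \<open>The function that equals \<open>(u x)\<^sup>2\<close> at \<open>x\<close> and 0
  elsewhere lies below \<open>u\<^sup>2\<close>. Thus evaluation at an atom is bounded on the unit
  ball, as the diagonal argument for compactness requires.\<close>

lemma atom_square_le:
  assumes "u \<in> L2_space M" "x \<in> space M"
  shows "(u x)\<^sup>2 * measure M {x} \<le> L2_inner M u u"
proof -
  have "(u x)\<^sup>2 * measure M {x} = (LINT y|M. (u x)\<^sup>2 * indicator {x} y)"
    using assms by (simp add: Int_absorb2)
  also have "\<dots> \<le> (LINT y|M. (u y)\<^sup>2)"
    using assms by (intro integral_mono integrable_mult_right integrable_real_indicator)
      (auto simp: sets_eq_Pow less_top[symmetric] L2_space_iff indicator_def)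
  finally show ?thesis by (simp add: L2_inner_self)
qed

text \<open>Truncating at height \<open>R\<close> splits \<open>\<bar>v\<bar> \<le> min \<bar>v\<bar> R + v\<^sup>2 / R\<close>: dominated convergence handles
  the first part, the \<open>L\<^sup>2\<close> bound the second.\<close>

lemma pointwise_imp_L1_tendsto:
  assumes L2: "\<And>n. v n \<in> L2_space M" and bound: "\<And>n. L2_inner M (v n) (v n) \<le> B"
    and lim: "\<And>x. x \<in> space M \<Longrightarrow> (\<lambda>n. v n x) \<longlonglongrightarrow> 0"
  shows "(\<lambda>n. LINT x|M. \<bar>v n x\<bar>) \<longlonglongrightarrow> 0"
proof (rule LIMSEQ_I)
  fix r :: real assume r: "0 < r"
  have B: "0 \<le> B" using bound[of 0] L2_inner_self_nonneg[of "v 0"] by simp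
  \<comment> \<open>Chosen so that the tail \<open>B / R\<close> stays below \<open>r / 2\<close>;
    the added 1 keeps \<open>R\<close> positive when \<open>B\<close> is 0.\<close>
  define R where "R = 2 * (B + 1) / r"
  have R: "0 < R" using B r by (simp add: R_def)
  have BR: "B / R < r / 2" using B r by (simp add: R_def field_simps)
  have "(\<lambda>n. LINT x|M. min \<bar>v n x\<bar> R) \<longlonglongrightarrow> (LINT x|M. 0)"
  proof (rule integral_dominated_convergence[where w="\<lambda>_. R"])
    show "AE x in M. (\<lambda>n. min \<bar>v n x\<bar> R) \<longlonglongrightarrow> 0"
    proof (rule AE_I2)
      fix x assume "x \<in> space M"
      then have "(\<lambda>n. min \<bar>v n x\<bar> R) \<longlonglongrightarrow> min \<bar>0\<bar> R"
        by (intro tendsto_intros lim)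
      then show "(\<lambda>n. min \<bar>v n x\<bar> R) \<longlonglongrightarrow> 0" using R by simp
    qed
  qed (use R in auto)
  then obtain n0 where n0: "\<And>n. n \<ge> n0 \<Longrightarrow> \<bar>LINT x|M. min \<bar>v n x\<bar> R\<bar> < r / 2"
    using LIMSEQ_D[of _ 0 "r/2"] r by fastforce
  have "(LINT x|M. \<bar>v n x\<bar>) < r" if "n \<ge> n0" for n
  proof -
    have "\<bar>a\<bar> \<le> min \<bar>a\<bar> R + a\<^sup>2 / R" for a
    proof (cases "\<bar>a\<bar> \<le> R")
      case False
      then have "\<bar>a\<bar> * R \<le> \<bar>a\<bar> * \<bar>a\<bar>" using R by (intro mult_left_mono) auto
      then have "\<bar>a\<bar> \<le> a\<^sup>2 / R" using R by (simp add: pos_le_divide_eq power2_eq_square)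
      then show ?thesis using R False by (simp add: min_def)
    qed (use R in simp)
    moreover have int: "integrable M (\<lambda>x. min \<bar>v n x\<bar> R)"
      using R by (intro integrable_const_bound[where B=R]) auto
    ultimately have "(LINT x|M. \<bar>v n x\<bar>) \<le> (LINT x|M. min \<bar>v n x\<bar> R + (v n x)\<^sup>2 / R)"
      using L2[of n] L2_integrable[OF L2, of n] by (intro integral_mono) (auto simp: L2_space_iff)
    also have "\<dots> = (LINT x|M. min \<bar>v n x\<bar> R) + L2_inner M (v n) (v n) / R"
      using int L2[of n] by (simp add: L2_space_iff L2_inner_self)
    also have "\<dots> \<le> (LINT x|M. min \<bar>v n x\<bar> R) + B / R"
      using R bound[of n] by (simp add: divide_right_mono)
    also have "\<dots> < r" using n0[OF that] BR by linarith
    finally show ?thesis .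
  qed
  then show "\<exists>n0. \<forall>n\<ge>n0. norm ((LINT x|M. \<bar>v n x\<bar>) - 0) < r"
    by (intro exI[of _ n0]) (auto simp: abs_of_nonneg)
qed

text \<open>A diagonal subsequence converges at each of the countably many atoms, Fatou's lemma
  keeps the limit in the unit ball, and the L2 bound upgrades pointwise to L1 convergence.
  Convergence in the L2 norm could fail, but L1 is all that the quadratic form needs.\<close>

lemma L2_ball_compact:
  assumes L2: "\<And>n. u n \<in> L2_space M" and bound: "\<And>n. L2_inner M (u n) (u n) \<le> 1"
  obtains k v where "strict_mono (k::nat \<Rightarrow> nat)" "v \<in> L2_space M" "L2_inner M v v \<le> 1"
    "(\<lambda>n. LINT x|M. \<bar>u (k n) x - v x\<bar>) \<longlonglongrightarrow> 0"
proof -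
  \<comment> \<open>Weighting by the square root of the mass makes the values at all atoms bounded
    by the same constant 1, as the diagonal extraction demands.\<close>
  define f where "f n x = sqrt (measure M {x}) * u n x" for n x
  have "norm (f n x) \<le> 1" if "x \<in> space M" for n x
  proof -
    have "(f n x)\<^sup>2 \<le> 1"
      using atom_square_le[OF L2 that, of n] bound[of n]
      by (simp add: f_def power_mult_distrib mult.commute)
    then show ?thesis by (simp add: abs_square_le_1)
  qed
  then obtain k where k: "strict_mono (k::nat\<Rightarrow>nat)"
    and ex: "\<And>x. x \<in> space M \<Longrightarrow> \<exists>l. (\<lambda>n. f (k n) x) \<longlonglongrightarrow> l"
    using function_convergent_subsequence[OF countable_space, of f 1] by blast
  obtain l where l: "\<And>x. x \<in> space M \<Longrightarrow> (\<lambda>n. f (k n) x) \<longlonglongrightarrow> l x"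
    using ex by metis
  define v where "v x = l x / sqrt (measure M {x})" for x
  have lim: "(\<lambda>n. u (k n) x) \<longlonglongrightarrow> v x" if x: "x \<in> space M" for x
  proof -
    have "(\<lambda>n. f (k n) x / sqrt (measure M {x})) \<longlonglongrightarrow> v x"
      unfolding v_def using atom_pos[OF x] by (intro tendsto_intros l x) simp
    then show ?thesis using atom_pos[OF x] by (simp add: f_def)
  qed
  have "(\<integral>\<^sup>+x. ennreal ((v x)\<^sup>2) \<partial>M) = (\<integral>\<^sup>+x. liminf (\<lambda>n. ennreal ((u (k n) x)\<^sup>2)) \<partial>M)"
  proof (rule nn_integral_cong)
    fix x assume "x \<in> space M"
    then have "(\<lambda>n. ennreal ((u (k n) x)\<^sup>2)) \<longlonglongrightarrow> ennreal ((v x)\<^sup>2)"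
      by (intro tendsto_ennrealI tendsto_power lim)
    from lim_imp_Liminf[OF _ this]
    show "ennreal ((v x)\<^sup>2) = liminf (\<lambda>n. ennreal ((u (k n) x)\<^sup>2))"
      by simp
  qed
  also have "\<dots> \<le> liminf (\<lambda>n. \<integral>\<^sup>+x. ennreal ((u (k n) x)\<^sup>2) \<partial>M)"
    by (rule nn_integral_liminf) simp
  also have "\<dots> \<le> 1"
  proof -
    have "(\<integral>\<^sup>+x. ennreal ((u n x)\<^sup>2) \<partial>M) \<le> 1" for n
      using L2[of n] bound[of n]
      by (subst nn_integral_eq_integral) (auto simp: L2_space_iff L2_inner_self)
    then show ?thesis by (intro Liminf_le) auto
  qed
  finally have le1: "(\<integral>\<^sup>+x. ennreal ((v x)\<^sup>2) \<partial>M) \<le> 1" .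
  then have int: "integrable M (\<lambda>x. (v x)\<^sup>2)"
    by (intro integrableI_nonneg) (auto simp: less_top[symmetric] top_unique)
  have v1: "L2_inner M v v \<le> 1"
    using le1 int by (simp add: nn_integral_eq_integral L2_inner_self)
  have vL2: "v \<in> L2_space M" using int by (simp add: L2_space_iff)
  have "(\<lambda>n. LINT x|M. \<bar>u (k n) x - v x\<bar>) \<longlonglongrightarrow> 0"
  proof (rule pointwise_imp_L1_tendsto)
    show dL2: "(\<lambda>x. u (k n) x - v x) \<in> L2_space M" for n
      by (rule L2_diff[OF L2 vL2])
    show "L2_inner M (\<lambda>x. u (k n) x - v x) (\<lambda>x. u (k n) x - v x) \<le> 4" for n
    proof -
      have "L2_inner M (\<lambda>x. u (k n) x - v x) (\<lambda>x. u (k n) x - v x)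
          \<le> (LINT x|M. 2 * (u (k n) x)\<^sup>2 + 2 * (v x)\<^sup>2)"
        unfolding L2_inner_self
      proof (rule integral_mono)
        show "(u (k n) x - v x)\<^sup>2 \<le> 2 * (u (k n) x)\<^sup>2 + 2 * (v x)\<^sup>2" for x
          using zero_le_power2[of "u (k n) x + v x"] by (simp add: power2_diff power2_sum)
      qed (use dL2[of n] L2[of "k n"] vL2 in \<open>auto simp: L2_space_iff\<close>)
      also have "\<dots> = 2 * L2_inner M (u (k n)) (u (k n)) + 2 * L2_inner M v v"
        using L2[of "k n"] vL2 by (simp add: L2_space_iff L2_inner_self)
      finally show ?thesis using v1 bound[of "k n"] by simp
    qed
    show "(\<lambda>n. u (k n) x - v x) \<longlonglongrightarrow> 0" if "x \<in> space M" for x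
      using lim[OF that] by (simp add: LIM_zero_iff)
  qed
  with k vL2 v1 show ?thesis by (rule that)
qed

end

section \<open>Positive eigenvalues of symmetric operators\<close>

text \<open>The bound by the \<open>L\<^sup>1\<close> norm is the form in which the boundedness of an integral kernel is used;
  with it, \<open>L\<^sup>1\<close> convergence of a sequence suffices for convergence of the quadratic form.\<close>

locale symmetric_L1_operator = discrete_finite_measure M for M :: "'a measure" +
  fixes A :: "('a \<Rightarrow> real) \<Rightarrow> 'a \<Rightarrow> real" and C :: real
  assumes A_add: "\<lbrakk>u \<in> L2_space M; v \<in> L2_space M; x \<in> space M\<rbrakk>
      \<Longrightarrow> A (\<lambda>y. u y + v y) x = A u x + A v x"
    and A_scale: "\<lbrakk>u \<in> L2_space M; x \<in> space M\<rbrakk> \<Longrightarrow> A (\<lambda>y. c * u y) x = c * A u x"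
    and A_bound: "\<lbrakk>u \<in> L2_space M; x \<in> space M\<rbrakk> \<Longrightarrow> \<bar>A u x\<bar> \<le> C * (LINT y|M. \<bar>u y\<bar>)"
    and A_symmetric: "\<lbrakk>u \<in> L2_space M; v \<in> L2_space M\<rbrakk> \<Longrightarrow> L2_inner M (A u) v = L2_inner M u (A v)"
    and C_nonneg: "0 \<le> C"
begin

lemma A_L2 [simp]: "u \<in> L2_space M \<Longrightarrow> A u \<in> L2_space M"
  by (rule L2_bounded[OF A_bound])

lemma A_diff:
  assumes "u \<in> L2_space M" "v \<in> L2_space M" "x \<in> space M"
  shows "A (\<lambda>y. u y - v y) x = A u x - A v x"
  using A_add[OF assms(1) L2_scale[OF assms(2), of "-1"] assms(3)] A_scale[OF assms(2,3), of "-1"]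
  by simp

lemma L2_inner_A_le:
  assumes "u \<in> L2_space M" "v \<in> L2_space M"
  shows "\<bar>L2_inner M (A u) v\<bar> \<le> C * (LINT x|M. \<bar>u x\<bar>) * (LINT x|M. \<bar>v x\<bar>)"
  by (rule abs_integral_mult_le[OF assms(2) A_bound[OF assms(1)]])

lemma form_add:
  assumes "u \<in> L2_space M" "v \<in> L2_space M"
  shows "L2_inner M (A (\<lambda>x. u x + v x)) (\<lambda>x. u x + v x)
    = L2_inner M (A u) u + 2 * L2_inner M (A u) v + L2_inner M (A v) v"
proof -
  have "L2_inner M (A (\<lambda>x. u x + v x)) (\<lambda>x. u x + v x)
      = L2_inner M (\<lambda>x. A u x + A v x) (\<lambda>x. u x + v x)"
    using assms by (intro L2_inner_cong A_add)
  also have "\<dots> = L2_inner M (A u) u + L2_inner M (A u) v + (L2_inner M (A v) u + L2_inner M (A v) v)"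
    using assms by (simp add: L2_inner_add_left L2_inner_add_right L2_add)
  also have "L2_inner M (A v) u = L2_inner M (A u) v"
    using assms by (subst A_symmetric) (auto intro: L2_inner_commute)
  finally show ?thesis by simp
qed

lemma form_scale:
  assumes "u \<in> L2_space M"
  shows "L2_inner M (A (\<lambda>x. c * u x)) (\<lambda>x. c * u x) = c\<^sup>2 * L2_inner M (A u) u"
proof -
  have "L2_inner M (A (\<lambda>x. c * u x)) (\<lambda>x. c * u x) = L2_inner M (\<lambda>x. c * A u x) (\<lambda>x. c * u x)"
    using assms by (intro L2_inner_cong A_scale)
  then show ?thesis
    by (simp add: L2_inner_scale_left L2_inner_scale_right power2_eq_square)
qed

text \<open>With \<open>w = u n - v\<close>, the difference of the forms is
  \<open>L2_inner M (A w) (u n) + L2_inner M (A v) w\<close>, and both terms are at most a constant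
  times the L1 norm of \<open>w\<close>.\<close>

lemma form_tendsto:
  assumes u: "\<And>n. u n \<in> L2_space M" "\<And>n. (LINT x|M. \<bar>u n x\<bar>) \<le> R" and v: "v \<in> L2_space M"
    and lim: "(\<lambda>n. LINT x|M. \<bar>u n x - v x\<bar>) \<longlonglongrightarrow> 0"
  shows "(\<lambda>n. L2_inner M (A (u n)) (u n)) \<longlonglongrightarrow> L2_inner M (A v) v"
proof -
  define N where "N = (LINT x|M. \<bar>v x\<bar>)"
  let ?w = "\<lambda>n x. u n x - v x"
  have w: "?w n \<in> L2_space M" for n using u v by (intro L2_diff)
  have "\<bar>L2_inner M (A (u n)) (u n) - L2_inner M (A v) v\<bar>
      \<le> (LINT x|M. \<bar>?w n x\<bar>) * (C * (R + N))" for n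
  proof -
    have "L2_inner M (A (u n)) (u n) - L2_inner M (A v) v
        = L2_inner M (A (?w n)) (u n) + L2_inner M (A v) (?w n)"
    proof -
      have "L2_inner M (A (?w n)) (u n) = L2_inner M (\<lambda>x. A (u n) x - A v x) (u n)"
        using u v by (intro L2_inner_cong A_diff)
      then show ?thesis using u v by (simp add: L2_inner_diff_left L2_inner_diff_right)
    qed
    moreover have "\<bar>L2_inner M (A (?w n)) (u n)\<bar> \<le> C * (LINT x|M. \<bar>?w n x\<bar>) * R"
      using L2_inner_A_le[OF w u(1), of n n] C_nonneg
        mult_left_mono[OF u(2)[of n], of "C * (LINT x|M. \<bar>?w n x\<bar>)"] by simp
    moreover have "\<bar>L2_inner M (A v) (?w n)\<bar> \<le> C * N * (LINT x|M. \<bar>?w n x\<bar>)"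
      unfolding N_def by (rule L2_inner_A_le[OF v w])
    ultimately have "\<bar>L2_inner M (A (u n)) (u n) - L2_inner M (A v) v\<bar>
        \<le> C * (LINT x|M. \<bar>?w n x\<bar>) * R + C * N * (LINT x|M. \<bar>?w n x\<bar>)"
      by linarith
    also have "\<dots> = (LINT x|M. \<bar>?w n x\<bar>) * (C * (R + N))"
      by (simp add: algebra_simps)
    finally show ?thesis .
  qed
  then have "\<forall>\<^sub>F n in sequentially. norm (L2_inner M (A (u n)) (u n) - L2_inner M (A v) v)
      \<le> (LINT x|M. \<bar>?w n x\<bar>) * (C * (R + N))"
    by (intro always_eventually allI) (simp only: real_norm_def)
  then have "(\<lambda>n. L2_inner M (A (u n)) (u n) - L2_inner M (A v) v) \<longlonglongrightarrow> 0"
    by (rule Lim_null_comparison) (rule tendsto_mult_left_zero[OF lim])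
  then show ?thesis by (simp add: LIM_zero_iff)
qed

section \<open>Eigenfunctions and their successive construction\<close>

text \<open>The equation is required at every point; this agrees with the almost-everywhere equation
  of \<open>L2_eigenspace\<close>, since only the empty set is null.\<close>

definition eigenfunction :: "real \<Rightarrow> ('a \<Rightarrow> real) \<Rightarrow> bool" where
  "eigenfunction c e \<longleftrightarrow> e \<in> L2_space M \<and> (\<forall>x\<in>space M. A e x = c * e x)"

text \<open>\<open>A\<close> maps into bounded functions and \<open>e = A e / c\<close>. Boundedness
  is what makes orthogonality to \<open>e\<close> survive L1 limits.\<close>

lemma eigenfunction_bounded:
  assumes "eigenfunction c e" "c \<noteq> 0" "x \<in> space M"
  shows "\<bar>e x\<bar> \<le> C * (LINT y|M. \<bar>e y\<bar>) / \<bar>c\<bar>"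
  using A_bound[of e x] assms unfolding eigenfunction_def
  by (auto simp: field_simps abs_mult)

text \<open>The new eigenvector maximises the quadratic form on the unit ball of the orthogonal complement
  of the given ones.\<close>

lemma exists_next_eigenfunction:
  fixes k :: nat
  assumes e: "\<And>i. i < k \<Longrightarrow> eigenfunction (c i) (e i) \<and> c i > (0::real)"
    and w: "w \<in> L2_space M" "\<And>i. i < k \<Longrightarrow> L2_inner M w (e i) = 0"
    and pos: "0 < L2_inner M (A w) w"
  obtains v s where "eigenfunction s v" "0 < s" "L2_inner M v v = 1"
    "\<And>i. i < k \<Longrightarrow> L2_inner M v (e i) = 0"
proof -
  define V where "V = {u \<in> L2_space M. \<forall>i<k. L2_inner M u (e i) = 0}"
  define Q where "Q u = L2_inner M (A u) u" for u
  define G where "G = Q ` {u \<in> V. L2_inner M u u \<le> 1}"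
  define S where "S = Sup G"
  define R where "R = measure M (space M) + 1"
  have eL2: "e i \<in> L2_space M" if "i < k" for i using e[OF that] by (simp add: eigenfunction_def)
  have V_L2: "u \<in> L2_space M" if "u \<in> V" for u using that by (simp add: V_def)
  have V_add: "(\<lambda>x. u x + v x) \<in> V" if "u \<in> V" "v \<in> V" for u v
    using that eL2 by (auto simp: V_def L2_add L2_inner_add_left)
  have V_diff: "(\<lambda>x. u x - v x) \<in> V" if "u \<in> V" "v \<in> V" for u v
    using that eL2 by (auto simp: V_def L2_diff L2_inner_diff_left)
  have V_scale: "(\<lambda>x. a * u x) \<in> V" if "u \<in> V" for a u
    using that by (auto simp: V_def L2_scale L2_inner_scale_left)
  \<comment> \<open>The complement of eigenvectors is invariant: by symmetry, \<open>A\<close> can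
    be moved onto \<open>e i\<close>, where it only multiplies by \<open>c i\<close>.\<close>
  have V_A: "A u \<in> V" if "u \<in> V" for u
  proof -
    have "L2_inner M (A u) (e i) = 0" if i: "i < k" for i
    proof -
      have "L2_inner M (A u) (e i) = L2_inner M (A (e i)) u"
        using V_L2[OF \<open>u \<in> V\<close>] eL2[OF i] by (subst A_symmetric) (auto intro: L2_inner_commute)
      also have "\<dots> = L2_inner M (\<lambda>x. c i * e i x) u"
        using e[OF i] by (intro L2_inner_cong) (simp add: eigenfunction_def)
      also have "\<dots> = 0"
        using \<open>u \<in> V\<close> i L2_inner_commute[of "e i" u] by (simp add: L2_inner_scale_left V_def)
      finally show ?thesis .
    qed
    then show ?thesis using V_L2[OF that] by (simp add: V_def)
  qed
  have ball_L1: "(LINT x|M. \<bar>u x\<bar>) \<le> R" if "u \<in> V" "L2_inner M u u \<le> 1" for u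
    using L1_norm_le[OF V_L2[OF that(1)]] that(2) by (simp add: R_def)
  have R0: "0 \<le> R" by (simp add: R_def)
  have bdd: "bdd_above G"
  proof (rule bdd_aboveI)
    fix g assume "g \<in> G"
    then obtain u where u: "u \<in> V" "L2_inner M u u \<le> 1" "g = Q u" by (auto simp: G_def)
    have "\<bar>Q u\<bar> \<le> C * (LINT x|M. \<bar>u x\<bar>) * (LINT x|M. \<bar>u x\<bar>)"
      unfolding Q_def using V_L2[OF u(1)] by (intro L2_inner_A_le)
    also have "\<dots> \<le> C * R * R"
      using ball_L1[OF u(1,2)] C_nonneg R0 by (intro mult_mono mult_nonneg_nonneg) auto
    finally show "g \<le> C * R * R" using u(3) by simp
  qed
  have zero_V: "(\<lambda>_. 0) \<in> V" by (simp add: V_def L2_inner_def)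
  have zero_G: "Q (\<lambda>_. 0) \<in> G"
    unfolding G_def using zero_V by (intro imageI) (simp add: L2_inner_def)
  \<comment> \<open>The supremum over the ball extends to all of \<open>V\<close> because the form
    is homogeneous of degree 2; a vector of norm 0 vanishes everywhere and is treated apart.\<close>
  have Q_le: "Q u \<le> S * L2_inner M u u" if u: "u \<in> V" for u
  proof (cases "L2_inner M u u = 0")
    case True
    then have "u x = 0" if "x \<in> space M" for x using L2_inner_self_eq_0 V_L2[OF u] that by blast
    then have "Q u = L2_inner M (\<lambda>_. 0) (A u)"
      unfolding Q_def by (subst L2_inner_commute) (intro L2_inner_cong)
    then show ?thesis using True by (simp add: L2_inner_def)
  next
    case False
    define r where "r = sqrt (L2_inner M u u)"
    have r: "0 < r" "r\<^sup>2 = L2_inner M u u"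
      using False L2_inner_self_nonneg[of u] by (auto simp: r_def)
    have "L2_inner M (\<lambda>x. 1/r * u x) (\<lambda>x. 1/r * u x) = 1"
      using r by (simp only: L2_inner_scale_left L2_inner_scale_right flip: r(2)) (simp add: power2_eq_square)
    then have "Q (\<lambda>x. 1/r * u x) \<in> G"
      unfolding G_def using V_scale[OF u, of "1/r"] by (intro imageI) simp
    then have "Q (\<lambda>x. 1/r * u x) \<le> S"
      unfolding S_def by (intro cSup_upper bdd)
    moreover have "Q (\<lambda>x. 1/r * u x) = (1/r)\<^sup>2 * Q u"
      unfolding Q_def by (rule form_scale[OF V_L2[OF u]])
    ultimately have "Q u / L2_inner M u u \<le> S" using r(2) by (simp add: power_divide)
    moreover have "0 < L2_inner M u u" using False L2_inner_self_nonneg[of u] by simp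
    ultimately show ?thesis by (simp add: pos_divide_le_eq)
  qed
  have "w \<in> V" using w by (simp add: V_def)
  then have S: "0 < S"
    using Q_le[of w] pos L2_inner_self_nonneg[of w] unfolding Q_def
    by (smt (verit) mult_nonpos_nonneg)
  \<comment> \<open>A maximising sequence. The successor matters: \<open>1 / 0\<close> is 0 in HOL,
    and no value of \<open>Q\<close> on the ball exceeds \<open>S\<close> itself.\<close>
  have "\<exists>u. u \<in> V \<and> L2_inner M u u \<le> 1 \<and> S - 1 / Suc n < Q u" for n
  proof -
    have "S - 1 / Suc n < Sup G" by (simp add: S_def)
    then show ?thesis using less_cSup_iff[of G "S - 1 / Suc n"] zero_G bdd by (auto simp: G_def)
  qed
  then obtain u where u: "\<And>n. u n \<in> V" "\<And>n. L2_inner M (u n) (u n) \<le> 1"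
    "\<And>n. S - 1 / Suc n < Q (u n)"
    by metis
  obtain k' v where k': "strict_mono (k'::nat \<Rightarrow> nat)" and vL2: "v \<in> L2_space M"
    and v1: "L2_inner M v v \<le> 1" and lim: "(\<lambda>n. LINT x|M. \<bar>u (k' n) x - v x\<bar>) \<longlonglongrightarrow> 0"
    using L2_ball_compact[of u] u V_L2 by blast
  \<comment> \<open>Each \<open>u (k' n)\<close> is orthogonal to \<open>e i\<close>, so the pairing
    with \<open>v\<close> is that with the difference, up to sign; \<open>e i\<close> is bounded and
    the difference tends to 0 in L1.\<close>
  have v_orth: "L2_inner M v (e i) = 0" if i: "i < k" for i
  proof -
    define B where "B = C * (LINT y|M. \<bar>e i y\<bar>) / \<bar>c i\<bar>"
    have "\<bar>L2_inner M v (e i)\<bar> \<le> B * (LINT x|M. \<bar>u (k' n) x - v x\<bar>)" for n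
    proof -
      have "L2_inner M (e i) (\<lambda>x. u (k' n) x - v x) = - L2_inner M v (e i)"
        using u(1)[of "k' n"] vL2 eL2[OF i] i
        by (simp add: V_def L2_inner_diff_right L2_inner_commute[of "e i" v] L2_inner_commute[of "e i" "u (k' n)"])
      moreover have "\<bar>L2_inner M (e i) (\<lambda>x. u (k' n) x - v x)\<bar> \<le> B * (LINT x|M. \<bar>u (k' n) x - v x\<bar>)"
        unfolding B_def using e[OF i] V_L2[OF u(1)] vL2
        by (intro abs_integral_mult_le L2_diff eigenfunction_bounded) auto
      ultimately show ?thesis by simp
    qed
    then have "\<bar>L2_inner M v (e i)\<bar> \<le> 0"
      using LIMSEQ_le_const[OF tendsto_mult_right_zero[OF lim, of B]] by blast
    then show ?thesis by simp
  qed
  have vV: "v \<in> V" using vL2 v_orth by (simp add: V_def)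
  have "(\<lambda>n. Q (u (k' n))) \<longlonglongrightarrow> Q v"
    unfolding Q_def by (rule form_tendsto[where R=R]) (use u V_L2 ball_L1 vL2 lim in auto)
  moreover have "(\<lambda>n. S - 1 / Suc (k' n)) \<longlonglongrightarrow> S - 0"
    using LIMSEQ_subseq_LIMSEQ[OF LIMSEQ_Suc[OF lim_1_over_n] k']
    by (intro tendsto_diff tendsto_const) (simp add: o_def)
  ultimately have SQ: "S \<le> Q v"
    using u(3) by (intro LIMSEQ_le[of "\<lambda>n. S - 1 / Suc (k' n)" S "\<lambda>n. Q (u (k' n))"])
      (auto intro: less_imp_le)
  \<comment> \<open>The maximiser sits on the unit sphere:
    \<open>S \<le> Q v \<le> S * L2_inner M v v\<close> with \<open>S\<close> positive forces norm
    at least 1.\<close>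
  have vv: "L2_inner M v v = 1"
  proof -
    have "S * 1 \<le> S * L2_inner M v v" using SQ Q_le[OF vV] by simp
    then show ?thesis using S v1 by simp
  qed
  have Qv: "Q v = S" using SQ Q_le[OF vV] vv by simp
  \<comment> \<open>The residual of the eigenvalue equation. It lies in \<open>V\<close>, so it is
    an admissible direction of variation.\<close>
  define z where "z = (\<lambda>x. A v x - S * v x)"
  have zV: "z \<in> V" unfolding z_def by (intro V_diff V_A V_scale vV)
  have zz: "L2_inner M (A v) z - S * L2_inner M v z = L2_inner M z z"
  proof -
    have "L2_inner M (\<lambda>x. A v x - S * v x) z = L2_inner M (A v) z - S * L2_inner M v z"
      using vL2 V_L2[OF zV] by (simp add: L2_inner_diff_left L2_scale L2_inner_scale_left)
    then show ?thesis by (simp only: flip: z_def)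
  qed
  have "L2_inner M z z = 0"
  proof (rule ccontr)
    assume nz: "L2_inner M z z \<noteq> 0"
    define b where "b = L2_inner M z z"
    define a where "a = S * b - Q z"
    have b: "0 < b" using nz L2_inner_self_nonneg[of z] by (simp add: b_def)
    \<comment> \<open>First variation: the Rayleigh bound at \<open>v + t z\<close>, with its value
      at \<open>v\<close> cancelled. Taking \<open>t = 1\<close> shows \<open>a > 0\<close>, and
      then \<open>t = b / a\<close> contradicts \<open>b > 0\<close>.\<close>
    have ineq: "2 * t * b \<le> t\<^sup>2 * a" for t
    proof -
      let ?tz = "\<lambda>x. t * z x"
      have "Q (\<lambda>x. v x + ?tz x) \<le> S * L2_inner M (\<lambda>x. v x + ?tz x) (\<lambda>x. v x + ?tz x)"
        by (intro Q_le V_add V_scale vV zV)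
      moreover have "Q (\<lambda>x. v x + ?tz x) = Q v + 2 * (t * L2_inner M (A v) z) + t\<^sup>2 * Q z"
        unfolding Q_def
        unfolding form_add[OF vL2 L2_scale[OF V_L2[OF zV]]] form_scale[OF V_L2[OF zV]]
        by (simp only: L2_inner_scale_right)
      moreover have "L2_inner M (\<lambda>x. v x + ?tz x) (\<lambda>x. v x + ?tz x)
          = 1 + 2 * (t * L2_inner M v z) + t\<^sup>2 * b"
        using vL2 V_L2[OF zV] vv
        by (simp add: L2_inner_add_left L2_inner_add_right L2_add L2_scale L2_inner_scale_left
            L2_inner_scale_right L2_inner_commute[of z v] b_def power2_eq_square distrib_left)
      moreover have "L2_inner M (A v) z = b + S * L2_inner M v z" using zz by (simp add: b_def)
      ultimately show ?thesis using Qv by (simp add: a_def algebra_simps)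
    qed
    have a: "0 < a" using ineq[of 1] b by simp
    have "2 * (b / a) * b \<le> (b / a)\<^sup>2 * a" by (rule ineq)
    then have "2 * (b * b / a) \<le> b * b / a" using a by (simp add: power2_eq_square)
    then show False using a b by (simp add: field_simps)
  qed
  then have "eigenfunction S v"
    using L2_inner_self_eq_0[OF V_L2[OF zV]] vL2 by (auto simp: eigenfunction_def z_def)
  then show ?thesis using that S vv v_orth by blast
qed

text \<open>Induction on the number of eigenfunctions found. The hypothesis \<open>test\<close>
  stands in for an m-dimensional subspace on which the form is positive: such a subspace meets the
  orthogonal complement of fewer than \<open>m\<close> functions.\<close>

lemma exists_positive_eigenfunctions:
  fixes m :: nat
  assumes test: "\<And>k e. \<lbrakk>k < m; \<And>i. i < k \<Longrightarrow> e i \<in> L2_space M\<rbrakk> \<Longrightarrow>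
    \<exists>w\<in>L2_space M. (\<forall>i<k. L2_inner M w (e i) = 0) \<and> 0 < L2_inner M (A w) w"
  obtains e c where "\<And>i. i < m \<Longrightarrow> eigenfunction (c i) (e i)" "\<And>i. i < m \<Longrightarrow> (0::real) < c i"
    "\<And>i j. \<lbrakk>i < m; j < m\<rbrakk> \<Longrightarrow> L2_inner M (e i) (e j) = (if i = j then 1 else 0)"
proof -
  have "\<exists>e c. (\<forall>i<k. eigenfunction (c i) (e i) \<and> (0::real) < c i) \<and>
      (\<forall>i<k. \<forall>j<k. L2_inner M (e i) (e j) = (if i = j then 1 else 0))" if "k \<le> m" for k
    using that
  proof (induction k)
    case (Suc k)
    then obtain e c where e: "\<And>i. i < k \<Longrightarrow> eigenfunction (c i) (e i) \<and> (0::real) < c i"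
      and orth: "\<And>i j. i < k \<Longrightarrow> j < k \<Longrightarrow> L2_inner M (e i) (e j) = (if i = j then 1 else 0)"
      by auto
    obtain w where w: "w \<in> L2_space M" "\<And>i. i < k \<Longrightarrow> L2_inner M w (e i) = 0"
      "0 < L2_inner M (A w) w"
      using test[of k e] Suc.prems e by (auto simp: eigenfunction_def)
    obtain v s where v: "eigenfunction s v" "0 < s" "L2_inner M v v = 1"
      "\<And>i. i < k \<Longrightarrow> L2_inner M v (e i) = 0"
      by (rule exists_next_eigenfunction[where k=k and c=c and e=e and w=w]) (use e w in auto)
    have "L2_inner M (e i) v = 0" if "i < k" for i
      using v(4)[OF that] by (simp only: L2_inner_commute[of "e i"])
    then show ?case
      using e orth v by (intro exI[of _ "e(k := v)"] exI[of _ "c(k := s)"]) (auto simp: less_Suc_eq)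
  qed simp
  from this[of m] that show ?thesis by blast
qed

text \<open>Group the indices by eigenvalue. Those sharing the value \<open>s\<close> give
  independent vectors of its eigenspace, and the group sizes add up to \<open>m\<close>.\<close>

lemma pos_eigenvalues_L2_ge:
  assumes e: "\<And>i. i < m \<Longrightarrow> eigenfunction (c i) (e i)" "\<And>i. i < m \<Longrightarrow> (0::real) < c i"
    and orth: "\<And>i j. \<lbrakk>i < m; j < m\<rbrakk> \<Longrightarrow> L2_inner M (e i) (e j) = (if i = j then 1 else 0)"
  shows "enat m \<le> pos_eigenvalues_L2 M A"
proof -
  have dim: "enat (card {i. i < m \<and> c i = s}) \<le> L2_dim M (L2_eigenspace M A s)" for s
  proof -
    define I where "I = {i. i < m \<and> c i = s}"
    have "finite I" by (simp add: I_def)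
    then obtain h where h: "bij_betw h {..<card I} I"
      using ex_bij_betw_nat_finite[of I] by (auto simp: atLeast0LessThan)
    have hI: "h i < m" "c (h i) = s" if "i < card I" for i
      using h that by (auto simp: bij_betw_def I_def)
    have eL2: "e i \<in> L2_space M" if "i < m" for i using e(1)[OF that] by (simp add: eigenfunction_def)
    have "e (h i) \<in> L2_eigenspace M A s" if "i < card I" for i
      using e(1)[OF hI(1)[OF that]] hI(2)[OF that] by (auto simp: eigenfunction_def L2_eigenspace_def)
    moreover have "L2_independent M (card I) (\<lambda>i. e (h i))"
      unfolding L2_independent_def
    proof (intro allI impI)
      fix a j assume "AE x in M. (\<Sum>i<card I. a i * e (h i) x) = 0" and j: "j < card I"
      then have zero: "L2_inner M (\<lambda>x. \<Sum>i<card I. a i * e (h i) x) (e (h j)) = 0"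
        by (simp add: AE_iff_all L2_inner_def cong: Bochner_Integration.integral_cong)
      \<comment> \<open>Pairing the vanishing combination with \<open>e (h j)\<close> isolates its
        coefficient, by orthonormality and injectivity of \<open>h\<close>.\<close>
      have "a j = (\<Sum>i<card I. if i = j then a i else 0)"
        using j by simp
      also have "\<dots> = (\<Sum>i<card I. a i * L2_inner M (e (h i)) (e (h j)))"
        using hI j h by (intro sum.cong) (auto simp: orth bij_betw_def inj_on_def)
      also have "\<dots> = (\<Sum>i<card I. LINT x|M. a i * (e (h i) x * e (h j) x))"
        by (simp add: L2_inner_def)
      also have "\<dots> = (LINT x|M. (\<Sum>i<card I. a i * (e (h i) x * e (h j) x)))"
        using eL2 hI j L2_integrable_mult
        by (intro Bochner_Integration.integral_sum[symmetric] integrable_mult_right) auto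
      also have "\<dots> = 0"
        using zero by (simp add: L2_inner_def sum_distrib_right mult.assoc)
      finally show "a j = 0" .
    qed
    ultimately show ?thesis unfolding L2_dim_def I_def[symmetric]
      by (intro SUP_upper CollectI exI[of _ "\<lambda>i. e (h i)"]) auto
  qed
  define F where "F = c ` {..<m}"
  have "card {..<m} = (\<Sum>s\<in>F. card {i \<in> {..<m}. c i = s})"
    unfolding F_def card_eq_sum by (rule sum.image_gen) simp
  then have "m = (\<Sum>s\<in>F. card {i. i < m \<and> c i = s})" by simp
  then have "enat m = (\<Sum>s\<in>F. enat (card {i. i < m \<and> c i = s}))"
    by (simp flip: of_nat_eq_enat of_nat_sum)
  also have "\<dots> \<le> (\<Sum>s\<in>F. L2_dim M (L2_eigenspace M A s))"
    by (intro sum_mono dim)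
  also have "\<dots> \<le> pos_eigenvalues_L2 M A"
    unfolding pos_eigenvalues_L2_def using e(2) by (intro SUP_upper) (auto simp: F_def)
  finally show ?thesis .
qed

end

section \<open>Almost equidistant points\<close>

text \<open>Gaussian elimination by induction on the number of equations. The unknowns are indexed
  by an arbitrary finite set so that they can be points of the space.\<close>

lemma homogeneous_system_nontrivial_solution:
  fixes b :: "nat \<Rightarrow> 'a \<Rightarrow> real"
  assumes "finite J" "k < card J"
  obtains a where "\<And>i. i < k \<Longrightarrow> (\<Sum>j\<in>J. a j * b i j) = 0" "\<exists>j\<in>J. a j \<noteq> 0"
proof -
  have "\<exists>a. (\<forall>i<k. (\<Sum>j\<in>J. a j * b i j) = 0) \<and> (\<exists>j\<in>J. a j \<noteq> 0)"
    using assms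
  proof (induction k arbitrary: J b)
    case 0
    then have "J \<noteq> {}" by auto
    then show ?case by (intro exI[of _ "\<lambda>_. 1"]) auto
  next
    case (Suc k)
    show ?case
    proof (cases "\<exists>p\<in>J. b k p \<noteq> 0")
      case False
      obtain a where a: "\<forall>i<k. (\<Sum>j\<in>J. a j * b i j) = 0" "\<exists>j\<in>J. a j \<noteq> 0"
        using Suc.IH[of J b] Suc.prems by auto
      with False show ?thesis by (intro exI[of _ a]) (auto simp: less_Suc_eq)
    next
      case True
      then obtain p where p: "p \<in> J" "b k p \<noteq> 0" by blast
      \<comment> \<open>The unknown at the pivot \<open>p\<close> is eliminated from the other
        equations by subtracting multiples of equation \<open>k\<close>.\<close>
      define J' where "J' = J - {p}"
      have J': "finite J'" "J = insert p J'" "p \<notin> J'" "k < card J'"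
        using Suc.prems p by (auto simp: J'_def)
      obtain a where a: "\<And>i. i < k \<Longrightarrow> (\<Sum>j\<in>J'. a j * (b i j - b k j / b k p * b i p)) = 0"
        "\<exists>j\<in>J'. a j \<noteq> 0"
        using Suc.IH[OF J'(1,4), of "\<lambda>i j. b i j - b k j / b k p * b i p"] by auto
      \<comment> \<open>The value at \<open>p\<close> is the one that solves equation
        \<open>k\<close>.\<close>
      define a' where "a' = a(p := - (\<Sum>j\<in>J'. a j * b k j) / b k p)"
      have split: "(\<Sum>j\<in>J. a' j * b i j)
          = - (\<Sum>j\<in>J'. a j * b k j) / b k p * b i p + (\<Sum>j\<in>J'. a j * b i j)" for i
      proof -
        have "(\<Sum>j\<in>J'. a' j * b i j) = (\<Sum>j\<in>J'. a j * b i j)"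
          using J' by (intro sum.cong) (auto simp: a'_def)
        then show ?thesis using J' by (simp add: a'_def)
      qed
      have "(\<Sum>j\<in>J. a' j * b i j) = 0" if "i < Suc k" for i
      proof (cases "i = k")
        case True
        then show ?thesis using p by (simp add: split)
      next
        case False
        then have "(\<Sum>j\<in>J'. a j * b i j) = (\<Sum>j\<in>J'. a j * (b k j / b k p * b i p))"
          using a(1)[of i] that by (simp add: right_diff_distrib sum_subtractf)
        then show ?thesis
          by (simp add: split sum_distrib_right sum_divide_distrib sum_negf mult.assoc)
      qed
      moreover have "\<exists>j\<in>J. a' j \<noteq> 0" using a(2) J' by (auto simp: a'_def)
      ultimately show ?thesis by blast
    qed
  qed
  then show ?thesis using that by blast
qed

text \<open>Colour a pair by the interval of length \<epsilon> containing its squared distance.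
  Boundedness leaves finitely many colours, so Ramsey's theorem gives an infinite set of a single
  colour.\<close>

lemma (in Metric_space) exists_almost_equidistant:
  assumes "infinite M" and bounded: "\<And>x y. \<lbrakk>x \<in> M; y \<in> M\<rbrakk> \<Longrightarrow> d x y \<le> B" and "0 < \<epsilon>"
  obtains F t where "finite F" "card F = N" "F \<subseteq> M"
    "\<And>x y. \<lbrakk>x \<in> F; y \<in> F; x \<noteq> y\<rbrakk> \<Longrightarrow> t \<le> (d x y)\<^sup>2 \<and> (d x y)\<^sup>2 < t + \<epsilon>"
proof -
  \<comment> \<open>Colours are attached to unordered pairs, so the squared distance is read off the
    set itself: the double sum counts it twice and the diagonal contributes 0.\<close>
  define g where "g e = nat \<lfloor>(\<Sum>x\<in>e. \<Sum>y\<in>e. (d x y)\<^sup>2) / 2 / \<epsilon>\<rfloor>" for e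
  have g: "g {x, y} = nat \<lfloor>(d x y)\<^sup>2 / \<epsilon>\<rfloor>" if "x \<in> M" "y \<in> M" "x \<noteq> y" for x y
    using that by (simp add: g_def commute[of y x])
  have "\<forall>x\<in>M. \<forall>y\<in>M. x \<noteq> y \<longrightarrow> g {x, y} < nat \<lfloor>B\<^sup>2 / \<epsilon>\<rfloor> + 1"
  proof (intro ballI impI)
    fix x y assume xy: "x \<in> M" "y \<in> M" "x \<noteq> y"
    have "(d x y)\<^sup>2 / \<epsilon> \<le> B\<^sup>2 / \<epsilon>"
      using xy bounded \<open>0 < \<epsilon>\<close> by (intro divide_right_mono power_mono) auto
    then show "g {x, y} < nat \<lfloor>B\<^sup>2 / \<epsilon>\<rfloor> + 1"
      using g[OF xy] nat_mono[OF floor_mono] by fastforce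
  qed
  from Ramsey2[OF \<open>infinite M\<close> this] obtain Y n where Y: "Y \<subseteq> M" "infinite Y"
    "\<forall>x\<in>Y. \<forall>y\<in>Y. x \<noteq> y \<longrightarrow> g {x, y} = n"
    by blast
  obtain F where F: "finite F" "card F = N" "F \<subseteq> Y"
    using infinite_arbitrarily_large[OF Y(2), of N] by blast
  have "real n * \<epsilon> \<le> (d x y)\<^sup>2 \<and> (d x y)\<^sup>2 < real n * \<epsilon> + \<epsilon>" if xy: "x \<in> F" "y \<in> F" "x \<noteq> y" for x y
  proof -
    have "nat \<lfloor>(d x y)\<^sup>2 / \<epsilon>\<rfloor> = n"
      using g[of x y] Y F xy by (metis subsetD)
    moreover have "0 \<le> \<lfloor>(d x y)\<^sup>2 / \<epsilon>\<rfloor>" using \<open>0 < \<epsilon>\<close> by simp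
    ultimately have "\<lfloor>(d x y)\<^sup>2 / \<epsilon>\<rfloor> = int n" using nat_0_le by metis
    then have "real n \<le> (d x y)\<^sup>2 / \<epsilon>" "(d x y)\<^sup>2 / \<epsilon> < real n + 1"
      by (simp_all add: floor_eq_iff)
    then show ?thesis using \<open>0 < \<epsilon>\<close> by (simp add: field_simps)
  qed
  then show ?thesis using F Y(1) that[of F "real n * \<epsilon>"] by blast
qed

text \<open>On almost equidistant points the squared distances are \<open>t\<close> times (all-ones
  minus identity) plus an error with entries at most \<epsilon>. On vectors of zero sum the all-ones
  part vanishes, which leaves \<open>t / 2\<close> times the squared norm \<open>q\<close>, minus at
  most \<open>N * \<epsilon> * q / 2\<close>.\<close>

lemma (in Metric_space) exists_conditionally_positive_subset:
  assumes "infinite M" and bounded: "\<And>x y. \<lbrakk>x \<in> M; y \<in> M\<rbrakk> \<Longrightarrow> d x y \<le> B"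
    and "0 < \<delta>" and separated: "\<And>x y. \<lbrakk>x \<in> M; y \<in> M; x \<noteq> y\<rbrakk> \<Longrightarrow> \<delta> \<le> d x y"
  obtains F where "finite F" "card F = N" "F \<subseteq> M"
    "\<And>\<beta>. \<lbrakk>(\<Sum>x\<in>F. \<beta> x) = 0; \<exists>x\<in>F. \<beta> x \<noteq> 0\<rbrakk>
      \<Longrightarrow> 0 < (\<Sum>x\<in>F. \<beta> x * (- (1/2) * (\<Sum>y\<in>F. (d x y)\<^sup>2 * \<beta> y)))"
proof -
  \<comment> \<open>Small enough for \<open>N * \<epsilon> < t\<close>: squared distances are at
    least \<open>(N + 2) * \<epsilon>\<close>, and one \<epsilon> is lost in passing from them to
    \<open>t\<close>.\<close>
  define \<epsilon> where "\<epsilon> = \<delta>\<^sup>2 / (real N + 2)"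
  have \<epsilon>: "0 < \<epsilon>" using \<open>0 < \<delta>\<close> by (simp add: \<epsilon>_def)
  obtain F t where F: "finite F" "card F = N" "F \<subseteq> M"
    and t: "\<And>x y. \<lbrakk>x \<in> F; y \<in> F; x \<noteq> y\<rbrakk> \<Longrightarrow> t \<le> (d x y)\<^sup>2 \<and> (d x y)\<^sup>2 < t + \<epsilon>"
    using exists_almost_equidistant[OF assms(1,2) \<epsilon>] by metis
  have "0 < (\<Sum>x\<in>F. \<beta> x * (- (1/2) * (\<Sum>y\<in>F. (d x y)\<^sup>2 * \<beta> y)))"
    if sum0: "(\<Sum>x\<in>F. \<beta> x) = 0" and nz: "\<exists>x\<in>F. \<beta> x \<noteq> 0" for \<beta>
  proof -
    define q where "q = (\<Sum>x\<in>F. (\<beta> x)\<^sup>2)"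
    have q: "0 < q"
    proof -
      obtain x where "x \<in> F" "\<beta> x \<noteq> 0" using nz by blast
      then show ?thesis unfolding q_def using F by (intro sum_pos2[of _ x]) auto
    qed
    obtain x0 where x0: "x0 \<in> F" "\<beta> x0 \<noteq> 0" using nz by blast
    \<comment> \<open>A nonzero vector of zero sum needs two points; the distance between them
      bounds \<open>t\<close> from below.\<close>
    obtain y0 where y0: "y0 \<in> F" "y0 \<noteq> x0"
    proof -
      have "F \<noteq> {x0}" using sum0 x0 by auto
      then show ?thesis using that x0 by blast
    qed
    have "\<delta>\<^sup>2 \<le> (d x0 y0)\<^sup>2"
      using separated[of x0 y0] x0 y0 F \<open>0 < \<delta>\<close> by (intro power_mono) auto
    moreover have "\<delta>\<^sup>2 = (real N + 2) * \<epsilon>" by (simp add: \<epsilon>_def)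
    ultimately have t_large: "real N * \<epsilon> < t"
      using t[of x0 y0] x0 y0 \<epsilon> by (simp add: algebra_simps)
    define r where "r x y = (if x = y then 0 else (d x y)\<^sup>2 - t)" for x y
    have d2: "(d x y)\<^sup>2 = t - (if x = y then t else 0) + r x y" if "x \<in> F" "y \<in> F" for x y
      using that F by (auto simp: r_def)
    \<comment> \<open>Bounding each product by half the sum of squares makes every
      \<open>(\<beta> x)\<^sup>2\<close> appear with total weight
      \<open>N * \<epsilon>\<close>.\<close>
    have "(\<Sum>x\<in>F. \<Sum>y\<in>F. r x y * \<beta> x * \<beta> y) \<le> (\<Sum>x\<in>F. \<Sum>y\<in>F. \<epsilon> * (((\<beta> x)\<^sup>2 + (\<beta> y)\<^sup>2) / 2))"
    proof (intro sum_mono)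
      fix x y assume xy: "x \<in> F" "y \<in> F"
      have "\<bar>r x y\<bar> \<le> \<epsilon>" using t[OF xy] \<epsilon> by (auto simp: r_def)
      moreover have "\<bar>\<beta> x * \<beta> y\<bar> \<le> ((\<beta> x)\<^sup>2 + (\<beta> y)\<^sup>2) / 2"
        using sum_squares_bound[of "\<bar>\<beta> x\<bar>" "\<bar>\<beta> y\<bar>"] by (simp add: abs_mult)
      ultimately have "\<bar>r x y\<bar> * \<bar>\<beta> x * \<beta> y\<bar> \<le> \<epsilon> * (((\<beta> x)\<^sup>2 + (\<beta> y)\<^sup>2) / 2)"
        using \<epsilon> by (intro mult_mono) auto
      then have "\<bar>r x y * \<beta> x * \<beta> y\<bar> \<le> \<epsilon> * (((\<beta> x)\<^sup>2 + (\<beta> y)\<^sup>2) / 2)"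
        by (simp only: abs_mult mult.assoc)
      then show "r x y * \<beta> x * \<beta> y \<le> \<epsilon> * (((\<beta> x)\<^sup>2 + (\<beta> y)\<^sup>2) / 2)"
        by (rule abs_le_D1)
    qed
    also have "\<dots> = \<epsilon> * ((\<Sum>x\<in>F. \<Sum>y\<in>F. (\<beta> x)\<^sup>2) + (\<Sum>x\<in>F. \<Sum>y\<in>F. (\<beta> y)\<^sup>2)) / 2"
      by (simp only: sum.distrib sum_distrib_left[symmetric] sum_divide_distrib[symmetric] times_divide_eq_right)
    also have "\<dots> = real N * \<epsilon> * q"
      using F by (simp add: q_def sum_distrib_left[symmetric])
    finally have err: "(\<Sum>x\<in>F. \<Sum>y\<in>F. r x y * \<beta> x * \<beta> y) \<le> real N * \<epsilon> * q" .
    have inner: "(\<Sum>y\<in>F. (d x y)\<^sup>2 * \<beta> y) = (\<Sum>y\<in>F. r x y * \<beta> y) - t * \<beta> x" if x: "x \<in> F" for x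
    proof -
      have "(\<Sum>y\<in>F. (d x y)\<^sup>2 * \<beta> y)
          = (\<Sum>y\<in>F. t * \<beta> y - (if x = y then t * \<beta> y else 0) + r x y * \<beta> y)"
        using x by (intro sum.cong) (auto simp: d2 algebra_simps)
      also have "\<dots> = t * (\<Sum>y\<in>F. \<beta> y) - t * \<beta> x + (\<Sum>y\<in>F. r x y * \<beta> y)"
        using F x by (simp add: sum.distrib sum_subtractf sum_distrib_left)
      finally show ?thesis by (simp add: sum0)
    qed
    have "(\<Sum>x\<in>F. \<beta> x * (- (1/2) * (\<Sum>y\<in>F. (d x y)\<^sup>2 * \<beta> y)))
        = (\<Sum>x\<in>F. t / 2 * (\<beta> x)\<^sup>2 - 1 / 2 * (\<Sum>y\<in>F. r x y * \<beta> x * \<beta> y))"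
    proof (intro sum.cong refl)
      fix x assume "x \<in> F"
      have "(\<Sum>y\<in>F. r x y * \<beta> x * \<beta> y) = \<beta> x * (\<Sum>y\<in>F. r x y * \<beta> y)"
        by (simp add: sum_distrib_left mult_ac)
      then show "\<beta> x * (- (1/2) * (\<Sum>y\<in>F. (d x y)\<^sup>2 * \<beta> y))
          = t / 2 * (\<beta> x)\<^sup>2 - 1 / 2 * (\<Sum>y\<in>F. r x y * \<beta> x * \<beta> y)"
        unfolding inner[OF \<open>x \<in> F\<close>] by (simp add: algebra_simps power2_eq_square)
    qed
    also have "\<dots> = t / 2 * q - 1 / 2 * (\<Sum>x\<in>F. \<Sum>y\<in>F. r x y * \<beta> x * \<beta> y)"
      by (simp only: sum_subtractf sum_distrib_left q_def)
    also have "\<dots> > 0"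
    proof -
      have "real N * \<epsilon> * q < t * q" using t_large q by simp
      then show ?thesis using err by simp
    qed
    finally show ?thesis .
  qed
  then show ?thesis using F that by blast
qed

section \<open>The operators of squared distances\<close>

context discrete_finite_measure
begin

text \<open>The first factor is countable with all subsets measurable, so measurability of the
  sections suffices. This serves the use of Fubini's theorem below.\<close>

lemma borel_measurable_pair_any: "f \<in> borel_measurable (M \<Otimes>\<^sub>M M)" for f :: "'a \<times> 'a \<Rightarrow> real"
proof -
  have "sets M = sets (count_space (space M))" by (simp add: sets_eq_Pow)
  then have "sets (M \<Otimes>\<^sub>M M) = sets (count_space (space M) \<Otimes>\<^sub>M M)"
    by (intro sets_pair_measure_cong) auto
  moreover have "f \<in> borel_measurable (count_space (space M) \<Otimes>\<^sub>M M)"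
    by (rule measurable_pair_measure_countable1[OF countable_space]) simp
  ultimately show ?thesis using measurable_cong_sets by blast
qed

text \<open>The kernel is bounded by \<open>B\<^sup>2 / 2\<close>, which gives the L1 bound;
  symmetry is Fubini's theorem together with the symmetry of \<open>d\<close>.\<close>

lemma K_op_symmetric_L1_operator:
  assumes sym: "\<And>x y. \<lbrakk>x \<in> space M; y \<in> space M\<rbrakk> \<Longrightarrow> d x y = d y x"
    and bound: "\<And>x y. \<lbrakk>x \<in> space M; y \<in> space M\<rbrakk> \<Longrightarrow> \<bar>d x y\<bar> \<le> B"
  shows "symmetric_L1_operator M (K_op d M) (B\<^sup>2 / 2)"
proof
  have d2: "\<bar>(d x y)\<^sup>2\<bar> \<le> B\<^sup>2" if "x \<in> space M" "y \<in> space M" for x y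
  proof -
    have "\<bar>d x y\<bar>\<^sup>2 \<le> B\<^sup>2" by (rule power_mono[OF bound[OF that]]) simp
    then show ?thesis by simp
  qed
  have int: "integrable M (\<lambda>y. (d x y)\<^sup>2 * u y)" if "u \<in> L2_space M" "x \<in> space M" for u x
    by (rule L2_integrable_mult[OF L2_bounded[OF d2[OF that(2)]] that(1)])
  fix u v x and c :: real
  show "0 \<le> B\<^sup>2 / 2" by simp
  assume u: "u \<in> L2_space M"
  show "K_op d M (\<lambda>y. u y + v y) x = K_op d M u x + K_op d M v x"
    if "v \<in> L2_space M" "x \<in> space M"
    using int[OF u that(2)] int[OF that] by (simp add: K_op_def distrib_left add_divide_distrib)
  have K_bound: "\<bar>K_op d M u x\<bar> \<le> B\<^sup>2 / 2 * (LINT y|M. \<bar>u y\<bar>)" if "x \<in> space M" for x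
    using abs_integral_mult_le[OF u d2[OF that]] by (simp add: K_op_def L2_inner_def)
  show "K_op d M (\<lambda>y. c * u y) x = c * K_op d M u x"
    by (simp add: K_op_def mult.left_commute[of _ c])
  show "\<bar>K_op d M u x\<bar> \<le> B\<^sup>2 / 2 * (LINT y|M. \<bar>u y\<bar>)" if "x \<in> space M"
    using K_bound[OF that] .
  assume v: "v \<in> L2_space M"
  interpret pair_sigma_finite M M
    by (simp add: pair_sigma_finite_def sigma_finite_measure_axioms)
  \<comment> \<open>The inner integral of absolute values is a bounded function of \<open>x\<close>,
    hence square-integrable, and so is its partner \<open>\<bar>v x\<bar>\<close>.\<close>
  have "integrable (M \<Otimes>\<^sub>M M) (\<lambda>(x, y). (d x y)\<^sup>2 * u y * v x)"
  proof (rule Fubini_integrable)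
    have abs_u: "(\<lambda>y. \<bar>u y\<bar>) \<in> L2_space M" and abs_v: "(\<lambda>y. \<bar>v y\<bar>) \<in> L2_space M"
      using u v by (simp_all add: L2_space_iff)
    have "\<bar>LINT y|M. (d x y)\<^sup>2 * \<bar>u y\<bar>\<bar> \<le> B\<^sup>2 * (LINT y|M. \<bar>u y\<bar>)" if "x \<in> space M" for x
      using abs_integral_mult_le[OF abs_u d2[OF that]] by (simp add: L2_inner_def)
    then have "integrable M (\<lambda>x. (LINT y|M. (d x y)\<^sup>2 * \<bar>u y\<bar>) * \<bar>v x\<bar>)"
      by (intro L2_integrable_mult abs_v L2_bounded)
    then show "integrable M (\<lambda>x. LINT y|M. norm (case (x, y) of (x, y) \<Rightarrow> (d x y)\<^sup>2 * u y * v x))"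
      by (simp add: abs_mult)
    show "AE x in M. integrable M (\<lambda>y. case (x, y) of (x, y) \<Rightarrow> (d x y)\<^sup>2 * u y * v x)"
      using int[OF u] by (intro AE_I2) simp
  qed (rule borel_measurable_pair_any)
  from Fubini_integral[OF this]
  have fubini: "(LINT y|M. LINT x|M. (d x y)\<^sup>2 * u y * v x) = (LINT x|M. LINT y|M. (d x y)\<^sup>2 * u y * v x)"
    by simp
  have "L2_inner M (K_op d M u) v = - (1/2) * (LINT x|M. LINT y|M. (d x y)\<^sup>2 * u y * v x)"
    by (simp add: L2_inner_def K_op_def)
  also have "\<dots> = - (1/2) * (LINT y|M. LINT x|M. (d y x)\<^sup>2 * v x * u y)"
    unfolding fubini[symmetric]
    by (intro arg_cong[where f="\<lambda>t. - (1/2) * t"] Bochner_Integration.integral_cong refl)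
      (simp add: sym mult_ac)
  also have "\<dots> = L2_inner M (K_op d M v) u"
    by (simp add: L2_inner_def K_op_def)
  finally show "L2_inner M (K_op d M u) v = L2_inner M u (K_op d M v)"
    by (simp add: L2_inner_commute)
qed

section \<open>Test functions supported on finitely many points\<close>

text \<open>The density with respect to \<open>M\<close> of the signed measure with mass
  \<open>\<beta> x\<close> at each point \<open>x\<close> of \<open>F\<close>; dividing by the mass
  of the atom turns integrals into unweighted sums.\<close>

definition point_combination :: "'a set \<Rightarrow> ('a \<Rightarrow> real) \<Rightarrow> 'a \<Rightarrow> real" where
  "point_combination F \<beta> = (\<lambda>x. if x \<in> F then \<beta> x / measure M {x} else 0)"

lemma integral_point_combination:
  assumes "finite F" "F \<subseteq> space M"
  shows "(LINT x|M. f x * point_combination F \<beta> x) = (\<Sum>x\<in>F. f x * \<beta> x)"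
proof -
  have "(LINT x|M. f x * point_combination F \<beta> x)
      = (\<Sum>x\<in>F. f x * point_combination F \<beta> x * measure M {x})"
    using assms by (intro integral_finite_support) (auto simp: point_combination_def)
  also have "\<dots> = (\<Sum>x\<in>F. f x * \<beta> x)"
  proof (rule sum.cong[OF refl])
    fix x assume "x \<in> F"
    with assms atom_pos[of x] show "f x * point_combination F \<beta> x * measure M {x} = f x * \<beta> x"
      by (auto simp: point_combination_def)
  qed
  finally show ?thesis .
qed

lemma L2_inner_point_combination:
  assumes "finite F" "F \<subseteq> space M"
  shows "L2_inner M f (point_combination F \<beta>) = (\<Sum>x\<in>F. f x * \<beta> x)"
  using integral_point_combination[OF assms] by (simp add: L2_inner_def)

lemma point_combination_L2:
  assumes "finite F"
  shows "point_combination F \<beta> \<in> L2_space M"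
proof (rule L2_bounded)
  show "\<bar>point_combination F \<beta> x\<bar> \<le> (\<Sum>y\<in>F. \<bar>\<beta> y / measure M {y}\<bar>)" for x
    using assms by (auto simp: point_combination_def sum_nonneg intro!: member_le_sum)
qed

text \<open>Orthogonality to \<open>k\<close> functions and zero sum are \<open>Suc k\<close> linear
  conditions on \<open>card F\<close> coefficients, so a nonzero solution exists, and the form of
  \<open>K_op\<close> on it is the finite sum in \<open>pos\<close>.\<close>

lemma exists_orthogonal_K_positive:
  assumes F: "finite F" "F \<subseteq> space M" "Suc k < card F"
    and pos: "\<And>\<beta>. \<lbrakk>(\<Sum>x\<in>F. \<beta> x) = 0; \<exists>x\<in>F. \<beta> x \<noteq> 0\<rbrakk>
      \<Longrightarrow> 0 < (\<Sum>x\<in>F. \<beta> x * (- (1/2) * (\<Sum>y\<in>F. (d x y)\<^sup>2 * \<beta> y)))"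
  obtains w where "w \<in> L2_space M" "\<And>i. i < k \<Longrightarrow> L2_inner M w (e i) = 0"
    "L2_inner M w (\<lambda>_. 1) = 0" "0 < L2_inner M (K_op d M w) w"
proof -
  \<comment> \<open>Row \<open>k\<close> of the system consists of ones and encodes the zero
    sum.\<close>
  obtain \<beta> where \<beta>: "\<And>i. i < Suc k \<Longrightarrow> (\<Sum>x\<in>F. \<beta> x * (if i < k then e i x else 1)) = 0"
    "\<exists>x\<in>F. \<beta> x \<noteq> 0"
    using homogeneous_system_nontrivial_solution[OF F(1,3), of "\<lambda>i x. if i < k then e i x else 1"]
    by blast
  let ?w = "point_combination F \<beta>"
  note inner = L2_inner_point_combination[OF F(1,2)]
  have "L2_inner M ?w (e i) = 0" if "i < k" for i
    using \<beta>(1)[of i] that by (subst L2_inner_commute) (simp add: inner mult.commute)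
  moreover have sum0: "(\<Sum>x\<in>F. \<beta> x) = 0" using \<beta>(1)[of k] by simp
  then have "L2_inner M ?w (\<lambda>_. 1) = 0"
    by (subst L2_inner_commute) (simp add: inner)
  moreover have "L2_inner M (K_op d M ?w) ?w
      = (\<Sum>x\<in>F. \<beta> x * (- (1/2) * (\<Sum>y\<in>F. (d x y)\<^sup>2 * \<beta> y)))"
    unfolding inner K_op_def integral_point_combination[OF F(1,2)] by (simp only: mult.commute)
  then have "0 < L2_inner M (K_op d M ?w) ?w" using pos[OF sum0 \<beta>(2)] by simp
  ultimately show ?thesis using that point_combination_L2[OF F(1)] by blast
qed

section \<open>The projector and the compressed operator\<close>

lemma P_op_L2: "u \<in> L2_space M \<Longrightarrow> P_op M u \<in> L2_space M"
  unfolding P_op_def by (intro L2_diff L2_const)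

lemma P_op_symmetric:
  assumes "u \<in> L2_space M" "v \<in> L2_space M"
  shows "L2_inner M (P_op M u) v = L2_inner M u (P_op M v)"
proof -
  have const: "L2_inner M (\<lambda>_. a) w = a * L2_inner M w (\<lambda>_. 1)" for a w
    using L2_inner_scale_left[of a "\<lambda>_. 1" w] L2_inner_commute[of w "\<lambda>_. 1"] by simp
  define m where "m = L2_inner M (\<lambda>_. 1) (\<lambda>_. 1)"
  have "L2_inner M (P_op M u) v = L2_inner M u v - L2_inner M (\<lambda>_. L2_inner M u (\<lambda>_. 1) / m) v"
    unfolding P_op_def m_def using assms by (intro L2_inner_diff_left L2_const)
  moreover have "L2_inner M u (P_op M v)
      = L2_inner M u v - L2_inner M u (\<lambda>_. L2_inner M v (\<lambda>_. 1) / m)"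
    unfolding P_op_def m_def using assms by (intro L2_inner_diff_right L2_const)
  moreover have "L2_inner M u (\<lambda>_. L2_inner M v (\<lambda>_. 1) / m)
      = L2_inner M (\<lambda>_. L2_inner M v (\<lambda>_. 1) / m) u"
    by (rule L2_inner_commute)
  moreover have "L2_inner M (\<lambda>_. L2_inner M u (\<lambda>_. 1) / m) v
      = L2_inner M u (\<lambda>_. 1) / m * L2_inner M v (\<lambda>_. 1)"
    by (rule const)
  moreover have "L2_inner M (\<lambda>_. L2_inner M v (\<lambda>_. 1) / m) u
      = L2_inner M v (\<lambda>_. 1) / m * L2_inner M u (\<lambda>_. 1)"
    by (rule const)
  ultimately show ?thesis by simp
qed

lemma P_op_add:
  "\<lbrakk>u \<in> L2_space M; v \<in> L2_space M\<rbrakk> \<Longrightarrow> P_op M (\<lambda>x. u x + v x) = (\<lambda>x. P_op M u x + P_op M v x)"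
  by (simp add: P_op_def L2_inner_add_left add_divide_distrib fun_eq_iff)

lemma P_op_scale: "P_op M (\<lambda>x. c * u x) = (\<lambda>x. c * P_op M u x)"
  by (simp add: P_op_def L2_inner_scale_left right_diff_distrib)

text \<open>Linearity of \<open>A\<close> is known only at points of the space, not as an equality
  of functions; this carries it through the outer projector.\<close>

lemma P_op_cong:
  "\<lbrakk>\<And>x. x \<in> space M \<Longrightarrow> u x = v x; x \<in> space M\<rbrakk> \<Longrightarrow> P_op M u x = P_op M v x"
  using L2_inner_cong[of u v] by (simp add: P_op_def)

end

text \<open>For total mass 1, subtracting the mean at most doubles the L1 norm of the argument and
  at most doubles the sup-norm bound of the result, whence the factor 4.\<close>

lemma (in symmetric_L1_operator) compression_symmetric_L1_operator:
  assumes prob: "measure M (space M) = 1"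
  shows "symmetric_L1_operator M (\<lambda>u. P_op M (A (P_op M u))) (4 * C)"
proof
  have one: "L2_inner M (\<lambda>_. 1) (\<lambda>_. 1) = 1" using prob by (simp add: L2_inner_def)
  fix u v x and c :: real
  show "0 \<le> 4 * C" using C_nonneg by simp
  assume u: "u \<in> L2_space M"
  show "P_op M (A (P_op M (\<lambda>y. u y + v y))) x = P_op M (A (P_op M u)) x + P_op M (A (P_op M v)) x"
    if "v \<in> L2_space M" "x \<in> space M"
  proof -
    have "P_op M (A (P_op M (\<lambda>y. u y + v y))) x
        = P_op M (\<lambda>y. A (P_op M u) y + A (P_op M v) y) x"
      using u that by (intro P_op_cong) (auto simp: P_op_add A_add P_op_L2)
    then show ?thesis using u that by (simp add: P_op_add P_op_L2)
  qed
  show "P_op M (A (P_op M (\<lambda>y. c * u y))) x = c * P_op M (A (P_op M u)) x" if "x \<in> space M"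
  proof -
    have "P_op M (A (P_op M (\<lambda>y. c * u y))) x = P_op M (\<lambda>y. c * A (P_op M u) y) x"
      using u that by (intro P_op_cong) (auto simp: P_op_scale A_scale P_op_L2)
    then show ?thesis by (simp add: P_op_scale)
  qed
  show "L2_inner M (P_op M (A (P_op M u))) v = L2_inner M u (P_op M (A (P_op M v)))"
    if "v \<in> L2_space M"
    using u that by (simp add: P_op_symmetric A_symmetric P_op_L2)
  show "\<bar>P_op M (A (P_op M u)) x\<bar> \<le> 4 * C * (LINT y|M. \<bar>u y\<bar>)" if x: "x \<in> space M"
  proof -
    define N where "N = (LINT y|M. \<bar>u y\<bar>)"
    define a where "a = L2_inner M u (\<lambda>_. 1)"
    have Pu: "P_op M u = (\<lambda>y. u y - a)" by (simp add: P_op_def one a_def)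
    have "\<bar>a\<bar> \<le> N"
      using abs_integral_mult_le[OF u, of "\<lambda>_. 1" 1] by (simp add: a_def N_def L2_inner_commute[of u])
    moreover have "(LINT y|M. \<bar>P_op M u y\<bar>) \<le> (LINT y|M. \<bar>u y\<bar> + \<bar>a\<bar>)"
      using L2_integrable[OF u] L2_integrable[OF P_op_L2[OF u]]
      by (intro integral_mono) (auto simp: Pu)
    moreover have "(LINT y|M. \<bar>u y\<bar> + \<bar>a\<bar>) = N + \<bar>a\<bar>"
      using L2_integrable[OF u] prob by (simp add: N_def)
    ultimately have "(LINT y|M. \<bar>P_op M u y\<bar>) \<le> 2 * N" by linarith
    then have "C * (LINT y|M. \<bar>P_op M u y\<bar>) \<le> C * (2 * N)"
      using C_nonneg by (rule mult_left_mono)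
    then have AP: "\<bar>A (P_op M u) y\<bar> \<le> C * (2 * N)" if "y \<in> space M" for y
      using A_bound[OF P_op_L2[OF u] that] by linarith
    have "\<bar>L2_inner M (A (P_op M u)) (\<lambda>_. 1)\<bar> \<le> C * (2 * N) * (LINT y|M. \<bar>1\<bar>)"
      using AP by (intro abs_integral_mult_le) auto
    then have "\<bar>L2_inner M (A (P_op M u)) (\<lambda>_. 1)\<bar> \<le> C * (2 * N)" using prob by simp
    with AP[OF x] show ?thesis
      unfolding P_op_def[of M "A (P_op M u)"] one N_def[symmetric] by simp
  qed
qed

section \<open>Lower bounds for the number of positive eigenvalues of \<open>K_op\<close> and
  \<open>T_op\<close>\<close>

lemma enat_unbounded_imp_infinity:
  assumes "\<And>n. enat n \<le> x"
  shows "x = \<infinity>"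
  using assms[of "Suc (the_enat x)"] by (cases x) auto

context discrete_finite_measure
begin

context
  fixes d :: "'a \<Rightarrow> 'a \<Rightarrow> real" and B :: real
  assumes sym: "\<And>x y. \<lbrakk>x \<in> space M; y \<in> space M\<rbrakk> \<Longrightarrow> d x y = d y x"
    and bound: "\<And>x y. \<lbrakk>x \<in> space M; y \<in> space M\<rbrakk> \<Longrightarrow> \<bar>d x y\<bar> \<le> B"
begin

interpretation K: symmetric_L1_operator M "K_op d M" "B\<^sup>2 / 2"
  by (rule K_op_symmetric_L1_operator[OF sym bound])

text \<open>One of the \<open>Suc m\<close> points pays for the zero-sum condition. The
  eigenfunctions themselves are exposed because the matrix case builds a basis from them.\<close>

lemma exists_K_op_eigenfunctions:
  assumes F: "finite F" "F \<subseteq> space M" "card F = Suc m"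
    and pos: "\<And>\<beta>. \<lbrakk>(\<Sum>x\<in>F. \<beta> x) = 0; \<exists>x\<in>F. \<beta> x \<noteq> 0\<rbrakk>
      \<Longrightarrow> 0 < (\<Sum>x\<in>F. \<beta> x * (- (1/2) * (\<Sum>y\<in>F. (d x y)\<^sup>2 * \<beta> y)))"
  obtains e c where "\<And>i. i < m \<Longrightarrow> K.eigenfunction (c i) (e i)" "\<And>i. i < m \<Longrightarrow> (0::real) < c i"
    "\<And>i j. \<lbrakk>i < m; j < m\<rbrakk> \<Longrightarrow> L2_inner M (e i) (e j) = (if i = j then 1 else 0)"
proof (rule K.exists_positive_eigenfunctions[of m])
  fix k :: nat and e :: "nat \<Rightarrow> 'a \<Rightarrow> real" assume "k < m"
  with F(3) have "Suc k < card F" by simp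
  then show "\<exists>w\<in>L2_space M. (\<forall>i<k. L2_inner M w (e i) = 0) \<and> 0 < L2_inner M (K_op d M w) w"
    using exists_orthogonal_K_positive[OF F(1,2) _ pos] by metis
qed (rule that)

lemma pos_eigenvalues_K_op_ge:
  assumes F: "finite F" "F \<subseteq> space M" "card F = Suc m"
    and pos: "\<And>\<beta>. \<lbrakk>(\<Sum>x\<in>F. \<beta> x) = 0; \<exists>x\<in>F. \<beta> x \<noteq> 0\<rbrakk>
      \<Longrightarrow> 0 < (\<Sum>x\<in>F. \<beta> x * (- (1/2) * (\<Sum>y\<in>F. (d x y)\<^sup>2 * \<beta> y)))"
  shows "enat m \<le> pos_eigenvalues_L2 M (K_op d M)"
  by (rule exists_K_op_eigenfunctions[OF F pos]) (assumption+, rule K.pos_eigenvalues_L2_ge)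

text \<open>The test functions have mean zero, so the projector fixes them; being symmetric, it
  leaves their form equal to that of \<open>K_op\<close>.\<close>

lemma pos_eigenvalues_T_op_ge:
  assumes F: "finite F" "F \<subseteq> space M" "card F = Suc m"
    and pos: "\<And>\<beta>. \<lbrakk>(\<Sum>x\<in>F. \<beta> x) = 0; \<exists>x\<in>F. \<beta> x \<noteq> 0\<rbrakk>
      \<Longrightarrow> 0 < (\<Sum>x\<in>F. \<beta> x * (- (1/2) * (\<Sum>y\<in>F. (d x y)\<^sup>2 * \<beta> y)))"
    and prob: "measure M (space M) = 1"
  shows "enat m \<le> pos_eigenvalues_L2 M (T_op d M)"
proof -
  interpret T: symmetric_L1_operator M "T_op d M" "4 * (B\<^sup>2 / 2)"
    using K.compression_symmetric_L1_operator[OF prob] by (simp add: T_op_def[abs_def])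
  have "\<exists>w\<in>L2_space M. (\<forall>i<k. L2_inner M w (e i) = 0) \<and> 0 < L2_inner M (T_op d M w) w"
    if "k < m" for k :: nat and e
  proof -
    have "Suc k < card F" using that F(3) by simp
    then obtain w where w: "w \<in> L2_space M" "\<And>i. i < k \<Longrightarrow> L2_inner M w (e i) = 0"
      "L2_inner M w (\<lambda>_. 1) = 0" "0 < L2_inner M (K_op d M w) w"
      using exists_orthogonal_K_positive[OF F(1,2) _ pos] by metis
    have Pw: "P_op M w = w" by (simp add: P_op_def w(3))
    have "L2_inner M (T_op d M w) w = L2_inner M (K_op d M w) w"
      using w(1) by (simp add: T_op_def Pw P_op_symmetric)
    with w show ?thesis by (intro bexI[of _ w]) auto
  qed
  then show ?thesis
  proof (rule T.exists_positive_eigenfunctions[of m])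
    fix e c assume "\<And>i. i < m \<Longrightarrow> T.eigenfunction (c i) (e i)" "\<And>i. i < m \<Longrightarrow> (0::real) < c i"
      "\<And>i j. \<lbrakk>i < m; j < m\<rbrakk> \<Longrightarrow> L2_inner M (e i) (e j) = (if i = j then 1 else 0)"
    then show ?thesis by (rule T.pos_eigenvalues_L2_ge)
  qed
qed

end

end

section \<open>The matrices of squared distances\<close>

text \<open>The characteristic polynomial is the product of the linear factors of the diagonal
  entries, and the order of a root is additive over products.\<close>

lemma order_char_poly_upper_triangular:
  fixes D :: "real mat"
  assumes D: "D \<in> carrier_mat n n" "upper_triangular D"
  shows "order c (char_poly D) = card {i. i < n \<and> D $$ (i, i) = c}"
proof -
  have "order c (char_poly D) = (\<Sum>a\<leftarrow>diag_mat D. order c [:- a, 1:])"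
    unfolding char_poly_upper_triangular[OF D] by (subst order_prod_list) (auto simp: o_def)
  also have "\<dots> = (\<Sum>i<n. if D $$ (i, i) = c then 1 else 0)"
    using D(1)
    by (auto simp: diag_mat_def o_def order_linear' interv_sum_list_conv_sum_set_nat atLeast0LessThan
        intro!: sum.cong)
  also have "\<dots> = card {i. i < n \<and> D $$ (i, i) = c}"
    by (simp add: sum.If_cases lessThan_def Collect_conj_eq[symmetric])
  finally show ?thesis .
qed

text \<open>Similar matrices share their characteristic polynomial, so algebraic multiplicities
  become counts of diagonal entries of \<open>D\<close>.\<close>

lemma pos_eigenvalues_mat_similar_triangular:
  fixes A D :: "real mat"
  assumes sim: "similar_mat A D" and D: "D \<in> carrier_mat n n" "upper_triangular D"
  shows "pos_eigenvalues_mat A = card {i. i < n \<and> 0 < D $$ (i, i)}"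
proof -
  let ?I = "{i. i < n \<and> 0 < D $$ (i, i)}"
  have A: "A \<in> carrier_mat n n"
    using similar_matD[OF sim] D(1) by auto
  have ev: "eigenvalue A c \<longleftrightarrow> (\<exists>i<n. D $$ (i, i) = c)" for c
  proof -
    have "char_poly D \<noteq> 0" using degree_monic_char_poly[OF D(1)] by auto
    then have "poly (char_poly D) c = 0 \<longleftrightarrow> order c (char_poly D) \<noteq> 0"
      by (simp add: order_root)
    then show ?thesis
      unfolding eigenvalue_root_char_poly[OF A] char_poly_similar[OF sim]
        order_char_poly_upper_triangular[OF D] by auto
  qed
  have "{c. eigenvalue A c \<and> 0 < c} = (\<lambda>i. D $$ (i, i)) ` ?I"
    by (auto simp: ev)
  then have "pos_eigenvalues_mat A
      = (\<Sum>c\<in>(\<lambda>i. D $$ (i, i)) ` ?I. card {i. i < n \<and> D $$ (i, i) = c})"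
    by (simp add: pos_eigenvalues_mat_def char_poly_similar[OF sim]
        order_char_poly_upper_triangular[OF D])
  also have "\<dots> = (\<Sum>c\<in>(\<lambda>i. D $$ (i, i)) ` ?I. card {i \<in> ?I. D $$ (i, i) = c})"
    by (intro sum.cong refl arg_cong[where f=card]) auto
  also have "\<dots> = card ?I"
    unfolding card_eq_sum by (rule sum.image_gen[symmetric]) simp
  finally show ?thesis .
qed

text \<open>The last vector of an orthonormal basis is automatically an eigenvector of a symmetric matrix
  when the others are.\<close>

lemma pos_eigenvalues_mat_ge:
  fixes A P :: "real mat"
  assumes A: "A \<in> carrier_mat (Suc m) (Suc m)" and P: "P \<in> carrier_mat (Suc m) (Suc m)"
    and orth: "transpose_mat P * P = 1\<^sub>m (Suc m)" and sym: "transpose_mat A = A"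
    and eigen: "\<And>p j. \<lbrakk>p < Suc m; j < m\<rbrakk> \<Longrightarrow> (A * P) $$ (p, j) = c j * P $$ (p, j)"
    and pos: "\<And>j. j < m \<Longrightarrow> 0 < c j"
  shows "m \<le> pos_eigenvalues_mat A"
proof -
  let ?n = "Suc m"
  define D where "D = transpose_mat P * (A * P)"
  note T = transpose_carrier_mat[THEN iffD2, OF P]
  have D: "D \<in> carrier_mat ?n ?n" using A P T by (simp add: D_def)
  have D_sym: "transpose_mat D = D"
  proof -
    have "transpose_mat D = transpose_mat (A * P) * transpose_mat (transpose_mat P)"
      unfolding D_def using A P T by (intro transpose_mult) auto
    also have "\<dots> = transpose_mat P * A * P"
      using transpose_mult[OF A P] sym by simp
    also have "\<dots> = D" unfolding D_def by (rule assoc_mult_mat[OF T A P])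
    finally show ?thesis .
  qed
  have D_entry: "D $$ (i, j) = (if i = j then c j else 0)" if "i < ?n" "j < m" for i j
  proof -
    have "D $$ (i, j) = (\<Sum>p = 0..<?n. P $$ (p, i) * (A * P) $$ (p, j))"
      using that A P unfolding D_def by (simp add: scalar_prod_def)
    also have "\<dots> = (\<Sum>p = 0..<?n. P $$ (p, i) * (c j * P $$ (p, j)))"
      using that by (intro sum.cong refl) (simp only: eigen atLeastLessThan_iff)
    also have "\<dots> = c j * (transpose_mat P * P) $$ (i, j)"
      using that P by (simp add: scalar_prod_def sum_distrib_left distrib_left mult_ac)
    also have "\<dots> = (if i = j then c j else 0)"
      using that by (simp add: orth)
    finally show ?thesis .
  qed
  \<comment> \<open>An entry below the diagonal has \<open>j < i < Suc m\<close>, so it lies in one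
    of the first \<open>m\<close> columns, where \<open>D_entry\<close> applies.\<close>
  have "upper_triangular D"
  proof (rule upper_triangularI)
    fix i j assume "j < i" "i < dim_row D"
    then show "D $$ (i, j) = 0" using D by (simp add: D_entry)
  qed
  moreover have "similar_mat A D"
  proof (rule similar_matI)
    have orth': "P * transpose_mat P = 1\<^sub>m ?n"
      by (rule mat_mult_left_right_inverse[OF T P orth])
    show "P * transpose_mat P = 1\<^sub>m ?n" by (rule orth')
    show "transpose_mat P * P = 1\<^sub>m ?n" by (rule orth)
    show "{A, D, P, transpose_mat P} \<subseteq> carrier_mat ?n ?n" using A D P T by auto
    have "P * D * transpose_mat P = (P * transpose_mat P) * (A * P) * transpose_mat P"
      unfolding D_def using A P T by (subst assoc_mult_mat[of P _ _ "transpose_mat P" _ "A * P"]) auto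
    also have "\<dots> = A * (P * transpose_mat P)"
      using A P T by (simp add: orth')
    finally show "A = P * D * transpose_mat P" using A by (simp add: orth')
  qed
  ultimately have "pos_eigenvalues_mat A = card {i. i < ?n \<and> 0 < D $$ (i, i)}"
    using D by (intro pos_eigenvalues_mat_similar_triangular)
  moreover have "{..<m} \<subseteq> {i. i < ?n \<and> 0 < D $$ (i, i)}"
    using pos by (auto simp: D_entry)
  then have "card {..<m} \<le> card {i. i < ?n \<and> 0 < D $$ (i, i)}"
    by (intro card_mono) auto
  ultimately show ?thesis by simp
qed

text \<open>For the counting measure on \<open>set xs\<close>, \<open>K_op\<close> is the matrix
  acting on functions. Its \<open>m\<close> orthonormal eigenfunctions, completed by one more unit
  vector, form the columns of an orthogonal matrix.\<close>

lemma pos_eigenvalues_S_mat_ge: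
  assumes xs: "distinct xs" "length xs = Suc m"
    and sym: "\<And>x y. \<lbrakk>x \<in> set xs; y \<in> set xs\<rbrakk> \<Longrightarrow> d x y = d y x"
    and pos: "\<And>\<beta>. \<lbrakk>(\<Sum>x\<in>set xs. \<beta> x) = 0; \<exists>x\<in>set xs. \<beta> x \<noteq> 0\<rbrakk>
      \<Longrightarrow> 0 < (\<Sum>x\<in>set xs. \<beta> x * (- (1/2) * (\<Sum>y\<in>set xs. (d x y)\<^sup>2 * \<beta> y)))"
  shows "m \<le> pos_eigenvalues_mat (S_mat d xs)"
proof -
  let ?F = "set xs" and ?n = "Suc m"
  define M where "M = count_space ?F"
  define B where "B = (\<Sum>x\<in>?F. \<Sum>y\<in>?F. \<bar>d x y\<bar>)"
  have space: "space M = ?F" by (simp add: M_def)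
  interpret discrete_finite_measure M
  proof -
    interpret finite_measure M unfolding M_def by (rule finite_measure_count_space) simp
    show "discrete_finite_measure M"
      by unfold_locales (auto simp: M_def measure_count_space countable_finite)
  qed
  have bound: "\<bar>d x y\<bar> \<le> B" if "x \<in> ?F" "y \<in> ?F" for x y
  proof -
    have "\<bar>d x y\<bar> \<le> (\<Sum>y\<in>?F. \<bar>d x y\<bar>)" using that by (intro member_le_sum) auto
    also have "\<dots> \<le> B" unfolding B_def using that
      by (intro member_le_sum[where f="\<lambda>x. \<Sum>y\<in>?F. \<bar>d x y\<bar>"]) (auto intro: sum_nonneg)
    finally show ?thesis .
  qed
  have K: "symmetric_L1_operator M (K_op d M) (B\<^sup>2 / 2)"
    by (rule K_op_symmetric_L1_operator) (auto simp: space bound intro: sym)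
  interpret K: symmetric_L1_operator M "K_op d M" "B\<^sup>2 / 2" by (rule K)
  have sum_nth: "(\<Sum>x\<in>?F. f x) = (\<Sum>p = 0..<?n. f (xs ! p))" for f :: "'a \<Rightarrow> real"
    using xs by (simp add: sum_list_distinct_conv_sum_set[symmetric] sum_list_sum_nth)
  have inner: "L2_inner M u v = (\<Sum>p = 0..<?n. u (xs ! p) * v (xs ! p))" for u v
    by (simp only: L2_inner_def M_def lebesgue_integral_count_space_finite[OF finite_set] sum_nth)
  have K_op: "K_op d M u x = (\<Sum>p = 0..<?n. - (1/2) * (d x (xs ! p))\<^sup>2 * u (xs ! p))" for u x
    by (simp only: K_op_def M_def lebesgue_integral_count_space_finite[OF finite_set] sum_nth
        sum_distrib_left mult.assoc)
  have card: "card ?F = ?n" using xs by (simp add: distinct_card)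
  obtain e c where e: "\<And>i. i < m \<Longrightarrow> K.eigenfunction (c i) (e i)" "\<And>i. i < m \<Longrightarrow> (0::real) < c i"
    and orth: "\<And>i j. \<lbrakk>i < m; j < m\<rbrakk> \<Longrightarrow> L2_inner M (e i) (e j) = (if i = j then 1 else 0)"
  proof (rule exists_K_op_eigenfunctions[where d=d and B=B and F="?F" and m=m])
    show "d x y = d y x" if "x \<in> space M" "y \<in> space M" for x y
      using that sym by (simp add: space)
    show "\<bar>d x y\<bar> \<le> B" if "x \<in> space M" "y \<in> space M" for x y
      using that bound by (simp add: space)
  qed (use pos card space in auto)
  \<comment> \<open>The \<open>m\<close> orthogonality conditions in \<open>Suc m\<close> unknowns
    have a nonzero solution; normalised, it is the missing basis vector.\<close>
  obtain a where a: "\<And>i. i < m \<Longrightarrow> (\<Sum>x\<in>?F. a x * e i x) = 0" "\<exists>x\<in>?F. a x \<noteq> 0"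
    using homogeneous_system_nontrivial_solution[of ?F m e] card by auto
  define r where "r = L2_inner M a a"
  have "0 < (\<Sum>x\<in>?F. (a x)\<^sup>2)"
  proof -
    obtain x where "x \<in> ?F" "a x \<noteq> 0" using a(2) by blast
    then show ?thesis by (intro sum_pos2[of _ x]) auto
  qed
  then have r: "0 < r" by (simp only: r_def inner sum_nth power2_eq_square)
  define e' where "e' = e(m := (\<lambda>x. 1 / sqrt r * a x))"
  have last_orth: "L2_inner M (e' m) (e i) = 0" if "i < m" for i
    using a(1)[OF that] unfolding e'_def
    by (simp only: fun_upd_same L2_inner_scale_left inner sum_nth)
  have last_norm: "L2_inner M (e' m) (e' m) = 1"
    using r unfolding e'_def
    by (simp only: fun_upd_same L2_inner_scale_left L2_inner_scale_right flip: r_def)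
      (simp add: field_simps)
  have orth': "L2_inner M (e' i) (e' j) = (if i = j then 1 else 0)" if "i < ?n" "j < ?n" for i j
  proof -
    have old: "e' i = e i" if "i < m" for i using that by (simp add: e'_def)
    have "i < m \<or> i = m" "j < m \<or> j = m" using that by auto
    then show ?thesis
      using last_orth last_norm L2_inner_commute[of "e i" "e' m"] by (auto simp: old orth)
  qed
  define P where "P = Matrix.mat ?n ?n (\<lambda>(p, j). e' j (xs ! p))"
  have S: "S_mat d xs \<in> carrier_mat ?n ?n" using xs by (simp add: S_mat_def)
  show ?thesis
  proof (rule pos_eigenvalues_mat_ge[OF S])
    show "P \<in> carrier_mat ?n ?n" by (simp add: P_def)
    show "transpose_mat P * P = 1\<^sub>m ?n"
    proof (rule eq_matI)
      fix i j assume "i < dim_row (1\<^sub>m ?n)" "j < dim_col (1\<^sub>m ?n)"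
      then have ij: "i < ?n" "j < ?n" by simp_all
      then have "(transpose_mat P * P) $$ (i, j) = (\<Sum>p = 0..<?n. e' i (xs ! p) * e' j (xs ! p))"
        unfolding P_def by (simp add: scalar_prod_def)
      then show "(transpose_mat P * P) $$ (i, j) = 1\<^sub>m ?n $$ (i, j)"
        using orth'[OF ij] ij unfolding inner by simp
    qed (auto simp: P_def)
    show "transpose_mat (S_mat d xs) = S_mat d xs"
    proof (rule eq_matI)
      fix i j assume "i < dim_row (S_mat d xs)" "j < dim_col (S_mat d xs)"
      then show "transpose_mat (S_mat d xs) $$ (i, j) = S_mat d xs $$ (i, j)"
        using sym[of "xs ! i" "xs ! j"] by (simp add: S_mat_def)
    qed (auto simp: S_mat_def)
    show "0 < c j" if "j < m" for j by (rule e(2)[OF that])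
    fix p j assume pj: "p < ?n" "j < m"
    have "(S_mat d xs * P) $$ (p, j)
        = (\<Sum>q = 0..<?n. - (1/2) * (d (xs ! p) (xs ! q))\<^sup>2 * e' j (xs ! q))"
      using pj xs unfolding P_def S_mat_def by (simp add: scalar_prod_def)
    also have "\<dots> = K_op d M (e j) (xs ! p)"
      using pj by (simp add: K_op e'_def)
    also have "\<dots> = c j * e j (xs ! p)"
      using e(1)[OF pj(2)] pj(1) xs(2) by (simp add: K.eigenfunction_def space)
    also have "\<dots> = c j * P $$ (p, j)"
      using pj by (simp add: P_def e'_def)
    finally show "(S_mat d xs * P) $$ (p, j) = c j * P $$ (p, j)" .
  qed
qed

section \<open>Discreteness of separated spaces and the main result\<close>

text \<open>A ball of radius \<delta> contains only its centre.\<close>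

lemma (in Metric_space) separated_imp_openin:
  assumes "0 < \<delta>" and separated: "\<And>x y. \<lbrakk>x \<in> M; y \<in> M; x \<noteq> y\<rbrakk> \<Longrightarrow> \<delta> \<le> d x y" and "U \<subseteq> M"
  shows "openin mtopology U"
  unfolding openin_mtopology
proof (intro conjI ballI allI impI)
  fix x assume "x \<in> U"
  then have "mball x \<delta> \<subseteq> U"
    using separated \<open>U \<subseteq> M\<close> by (force simp: mball_def)
  then show "\<exists>r>0. mball x r \<subseteq> U" using \<open>0 < \<delta>\<close> by blast
qed (use assms in auto)

text \<open>A countable dense set is closed, since every subset is, and therefore is the whole
  space.\<close>

lemma (in Metric_space) separated_separable_imp_countable:
  assumes "0 < \<delta>" and "\<And>x y. \<lbrakk>x \<in> M; y \<in> M; x \<noteq> y\<rbrakk> \<Longrightarrow> \<delta> \<le> d x y"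
    and sep: "separable_space mtopology"
  shows "countable M"
proof -
  obtain D where D: "countable D" "D \<subseteq> M" "mtopology closure_of D = M"
    using sep by (auto simp: separable_space_def)
  have "openin mtopology (M - D)" by (rule separated_imp_openin[OF assms(1,2)]) auto
  then have "closedin mtopology D" using D(2) by (simp add: closedin_def)
  then have "D = M" using D(3) closure_of_closedin by metis
  then show ?thesis using D(1) by simp
qed

theorem proposition6p4:
  fixes X :: "'a set" and d :: "'a \<Rightarrow> 'a \<Rightarrow> real"
  assumes "Metric_space X d"
    and "Metric_space.mbounded X d X"
    and "infinite X"
    and "separable_space (Metric_space.mtopology X d)"
    and "\<exists>\<delta>\<^sub>0>0. \<forall>x\<in>X. \<forall>y\<in>X. x \<noteq> y \<longrightarrow> \<delta>\<^sub>0 \<le> d x y"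
  shows "s_plus_space X d = \<infinity> \<and>
    (\<forall>\<mu>. borel_prob_measure X d \<mu> \<and> measure_supp X d \<mu> = X \<longrightarrow>
       pos_eigenvalues_L2 \<mu> (T_op d \<mu>) = \<infinity> \<and>
       pos_eigenvalues_L2 \<mu> (K_op d \<mu>) = \<infinity>)"
proof -
  interpret Metric_space X d by (rule assms(1))
  obtain \<delta> where \<delta>: "0 < \<delta>" "\<And>x y. \<lbrakk>x \<in> X; y \<in> X; x \<noteq> y\<rbrakk> \<Longrightarrow> \<delta> \<le> d x y"
    using assms(5) by blast
  obtain B where B: "\<And>x y. \<lbrakk>x \<in> X; y \<in> X\<rbrakk> \<Longrightarrow> d x y \<le> B"
    using assms(2) by (auto simp: mbounded_alt)
  have subset: "\<exists>F. finite F \<and> card F = Suc m \<and> F \<subseteq> X \<and>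
      (\<forall>\<beta>. (\<Sum>x\<in>F. \<beta> x) = 0 \<longrightarrow> (\<exists>x\<in>F. \<beta> x \<noteq> 0)
        \<longrightarrow> 0 < (\<Sum>x\<in>F. \<beta> x * (- (1/2) * (\<Sum>y\<in>F. (d x y)\<^sup>2 * \<beta> y))))" for m
    by (rule exists_conditionally_positive_subset[OF assms(3) B \<delta>, of "Suc m"])
      (assumption+, blast)
  have "enat m \<le> s_plus_space X d" for m
  proof -
    obtain F where F: "finite F" "card F = Suc m" "F \<subseteq> X" and
      pos: "\<And>\<beta>. \<lbrakk>(\<Sum>x\<in>F. \<beta> x) = 0; \<exists>x\<in>F. \<beta> x \<noteq> 0\<rbrakk>
        \<Longrightarrow> 0 < (\<Sum>x\<in>F. \<beta> x * (- (1/2) * (\<Sum>y\<in>F. (d x y)\<^sup>2 * \<beta> y)))"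
      using subset[of m] by blast
    obtain xs where xs: "set xs = F" "distinct xs"
      using finite_distinct_list[OF F(1)] by blast
    have "m \<le> pos_eigenvalues_mat (S_mat d xs)"
    proof (rule pos_eigenvalues_S_mat_ge[OF xs(2)])
      show "length xs = Suc m" using distinct_card[OF xs(2)] xs(1) F(2) by simp
    qed (use pos xs(1) commute in auto)
    then have "enat m \<le> enat (pos_eigenvalues_mat (S_mat d xs))" by simp
    also have "\<dots> \<le> s_plus_space X d"
      unfolding s_plus_space_def using xs F(3) by (intro SUP_upper) auto
    finally show ?thesis .
  qed
  moreover have "pos_eigenvalues_L2 \<mu> (T_op d \<mu>) = \<infinity> \<and> pos_eigenvalues_L2 \<mu> (K_op d \<mu>) = \<infinity>"
    if \<mu>: "borel_prob_measure X d \<mu>" "measure_supp X d \<mu> = X" for \<mu>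
  proof -
    have space: "space \<mu> = X" and sets: "sets \<mu> = sigma_sets X {U. openin mtopology U}"
      using \<mu>(1) by (auto simp: borel_prob_measure_def)
    interpret prob_space \<mu> using \<mu>(1) by (simp add: borel_prob_measure_def)
    \<comment> \<open>Every subset is open, so the Borel sets are all subsets.\<close>
    have sets_Pow: "sets \<mu> = Pow X"
    proof
      show "sets \<mu> \<subseteq> Pow X" using sets.space_closed[of \<mu>] space by simp
      show "Pow X \<subseteq> sets \<mu>"
        unfolding sets using separated_imp_openin[OF \<delta>] by (auto intro: sigma_sets.Basic)
    qed
    interpret discrete_finite_measure \<mu>
    proof
      show "countable (space \<mu>)"
        unfolding space by (rule separated_separable_imp_countable[OF \<delta> assms(4)])
      show "sets \<mu> = Pow (space \<mu>)" by (simp add: sets_Pow space)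
      \<comment> \<open>Full support is tested on the open neighbourhood \<open>{x}\<close>, which
        makes each point an atom of positive mass.\<close>
      fix x assume "x \<in> space \<mu>"
      then have "x \<in> measure_supp X d \<mu>" "openin mtopology {x}"
        using separated_imp_openin[OF \<delta>, of "{x}"] \<mu>(2) space by auto
      then have "0 < emeasure \<mu> {x}" by (auto simp: measure_supp_def)
      then show "0 < measure \<mu> {x}" by (simp add: emeasure_eq_measure)
    qed
    have sym: "d x y = d y x" and bound: "\<bar>d x y\<bar> \<le> B" if "x \<in> space \<mu>" "y \<in> space \<mu>" for x y
      using that B commute by (auto simp: space)
    have "enat m \<le> pos_eigenvalues_L2 \<mu> (T_op d \<mu>) \<and> enat m \<le> pos_eigenvalues_L2 \<mu> (K_op d \<mu>)" for m
    proof -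
      obtain F where F: "finite F" "F \<subseteq> space \<mu>" "card F = Suc m" and
        pos: "\<And>\<beta>. \<lbrakk>(\<Sum>x\<in>F. \<beta> x) = 0; \<exists>x\<in>F. \<beta> x \<noteq> 0\<rbrakk>
          \<Longrightarrow> 0 < (\<Sum>x\<in>F. \<beta> x * (- (1/2) * (\<Sum>y\<in>F. (d x y)\<^sup>2 * \<beta> y)))"
        using subset[of m] space by blast
      show ?thesis
        using pos_eigenvalues_T_op_ge[OF sym bound F pos prob_space]
          pos_eigenvalues_K_op_ge[OF sym bound F pos] by blast
    qed
    then show ?thesis by (blast intro: enat_unbounded_imp_infinity)
  qed
  ultimately show ?thesis by (blast intro: enat_unbounded_imp_infinity)
qed

end
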